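(* Let $M$ be a smooth manifold, let $H \in \Omega^3(M)$ be a closed $3$-form, and let $\mathbb{L}_H \subset TM \oplus T^*M$ be an $H$-twisted Dirac structure on $M$. Let $f, g$ be $H$-admissible functions on $M$ with respect to $\mathbb{L}_H$. Then the product $fg$ and the bracket $\{f,g\} = X_f(g)$ are $H$-admissible functions. Moreover, this bracket satisfies both the Leibniz and the Jacobi identities, and it defines a Poisson algebra structure on the space $C^\infty_{\mathbb{L}_H}(M)$ of $H$-admissible functions.
   Context: The generalized tangent bundle $\mathbb{T}M = TM \oplus T^*M$ carries the symmetric pairing $\langle X \oplus \xi, Y \oplus \eta\rangle_+ = \frac12(\xi(Y) + \eta(X))$. The Courant bracket on $\Gamma(\mathbb{T}M)$ is $$[X \oplus \xi, Y \oplus \eta]_C = [X,Y] \oplus \left(\mathcal{L}_X \eta - \mathcal{L}_Y \xi - \tfrac12 d(\iota_X \eta - \iota_Y \xi)\right),$$ and, for a closed $3$-form $H$, the $H$-twisted Courant bracket is $$[X \oplus \xi, Y \oplus \eta]_H = [X \oplus \xi, Y \oplus \eta]_C - \iota_Y \iota_X H ,$$ where the $1$-form $\iota_Y\iota_X H = H(X,Y,\cdot)$ is subtracted from the $T^*M$-component. An $H$-twisted Dirac structure $\mathbb{L}_H$ is a maximally isotropic sub-bundle of $\mathbb{T}M$ (isotropic with respect to $\langle\cdot,\cdot\rangle_+$) whose space of sections is closed under $[\cdot,\cdot]_H$. A function $f \in C^\infty(M)$ is $H$-admissible (with respect to $\mathbb{L}_H$) if there exists a vector field $X_f \in \mathfrak{X}(M)$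 such that $(X_f, df) \in \Gamma(\mathbb{L}_H)$ and $d(df) + \iota_{X_f} H = 0$, i.e. $\iota_{X_f}H = 0$. Such an $X_f$ is called a Hamiltonian vector field of $f$; it need not be unique. The set of $H$-admissible functions is denoted $C^\infty_{\mathbb{L}_H}(M)$. The bracket of two $H$-admissible functions is $\{f,g\} = X_f(g)$; by isotropy of $\mathbb{L}_H$ it does not depend on the choice of $X_f$. *)

theory Defs
  imports "HOL-Analysis.Analysis"
begin

section \<open>Smooth manifolds\<close>

text \<open>Iterated directional derivatives; on an open subset of a finite-dimensional space
  \<^term>\<open>Ck_on k S f\<close> says that \<^term>\<open>f\<close> is of class $C^k$ on \<^term>\<open>S\<close>.\<close>

primrec Ck_on :: "nat \<Rightarrow> 'a::real_normed_vector set \<Rightarrow> ('a \<Rightarrow> 'b::real_normed_vector) \<Rightarrow> bool" where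
  "Ck_on 0 S f \<longleftrightarrow> continuous_on S f"
| "Ck_on (Suc k) S f \<longleftrightarrow> (\<forall>x\<in>S. f differentiable (at x)) \<and>
     (\<forall>v. Ck_on k S (\<lambda>x. frechet_derivative f (at x) v))"

definition Cinf_on :: "'a::real_normed_vector set \<Rightarrow> ('a \<Rightarrow> 'b::real_normed_vector) \<Rightarrow> bool" where
  "Cinf_on S f \<longleftrightarrow> (\<forall>k. Ck_on k S f)"

text \<open>A chart is a pair of its domain and its coordinate map.  The manifold \<open>M\<close> is the type
  \<open>'m\<close> (Hausdorff and second countable by its sort) with an atlas \<open>A\<close>; it need not be connected.
  The model space \<open>'e\<close> is only required to be a finite-dimensional inner product space, rather
  than of sort \<open>euclidean_space\<close>, so that dimension 0 is not excluded.\<close>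

type_synonym ('m, 'e) atlas = "('m set \<times> ('m \<Rightarrow> 'e)) set"

definition smooth_manifold ::
  "('m::{t2_space, second_countable_topology}, 'e::real_inner) atlas \<Rightarrow> bool" where
  "smooth_manifold A \<longleftrightarrow>
     (\<exists>B::'e set. finite B \<and> span B = UNIV) \<and>
     (\<forall>(D, \<phi>)\<in>A. open D \<and> open (\<phi> ` D) \<and> homeomorphism D (\<phi> ` D) \<phi> (inv_into D \<phi>)) \<and>
     (\<Union>(D, \<phi>)\<in>A. D) = UNIV \<and>
     (\<forall>(D, \<phi>)\<in>A. \<forall>(D', \<phi>')\<in>A. Cinf_on (\<phi> ` (D \<inter> D')) (\<phi>' \<circ> inv_into D \<phi>))"

text \<open>Smoothness of a real function on an open set \<open>U\<close>; its values outside \<open>U\<close> are irrelevant.\<close>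

definition smooth_on ::
  "('m::topological_space, 'e::real_inner) atlas \<Rightarrow> 'm set \<Rightarrow> ('m \<Rightarrow> real) \<Rightarrow> bool" where
  "smooth_on A U f \<longleftrightarrow> (\<forall>(D, \<phi>)\<in>A. Cinf_on (\<phi> ` (D \<inter> U)) (f \<circ> inv_into D \<phi>))"

definition smooth_near ::
  "('m::topological_space, 'e::real_inner) atlas \<Rightarrow> 'm \<Rightarrow> ('m \<Rightarrow> real) \<Rightarrow> bool" where
  "smooth_near A p f \<longleftrightarrow> (\<exists>U. open U \<and> p \<in> U \<and> smooth_on A U f)"

section \<open>Vectors, covectors, vector fields and forms\<close>

text \<open>A tangent vector at \<open>p\<close> is a derivation at \<open>p\<close> of the algebra of functions that are smooth
  on some neighbourhood of \<open>p\<close>.  Such a derivation depends only on germs: if \<open>h\<close> vanishes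
  near \<open>p\<close>, then \<open>h = h * k\<close> where \<open>k\<close> is 0 near \<open>p\<close> and 1 elsewhere, whence \<open>v h = 0\<close>.
  Tangent vectors, covectors and forms are total functions which are set to 0 outside their
  mathematical domain, so that equality of the HOL functions is the intended equality.\<close>

type_synonym 'm tvec = "('m \<Rightarrow> real) \<Rightarrow> real"
type_synonym 'm covec = "'m tvec \<Rightarrow> real"

definition tangent_space ::
  "('m::topological_space, 'e::real_inner) atlas \<Rightarrow> 'm \<Rightarrow> 'm tvec set" where
  "tangent_space A p = {v.
     (\<forall>f. \<not> smooth_near A p f \<longrightarrow> v f = 0) \<and>
     (\<forall>f g. smooth_near A p f \<longrightarrow> smooth_near A p g \<longrightarrow> v (\<lambda>x. f x + g x) = v f + v g) \<and>
     (\<forall>c f. smooth_near A p f \<longrightarrow> v (\<lambda>x. c * f x) = c * v f) \<and>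
     (\<forall>f g. smooth_near A p f \<longrightarrow> smooth_near A p g \<longrightarrow>
        v (\<lambda>x. f x * g x) = v f * g p + f p * v g)}"

definition cotangent_space ::
  "('m::topological_space, 'e::real_inner) atlas \<Rightarrow> 'm \<Rightarrow> 'm covec set" where
  "cotangent_space A p = {\<alpha>.
     (\<forall>v. v \<notin> tangent_space A p \<longrightarrow> \<alpha> v = 0) \<and>
     (\<forall>u\<in>tangent_space A p. \<forall>v\<in>tangent_space A p. \<alpha> (\<lambda>f. u f + v f) = \<alpha> u + \<alpha> v) \<and>
     (\<forall>c. \<forall>v\<in>tangent_space A p. \<alpha> (\<lambda>f. c * v f) = c * \<alpha> v)}"

definition vector_field_on ::
  "('m::topological_space, 'e::real_inner) atlas \<Rightarrow> 'm set \<Rightarrow> ('m \<Rightarrow> 'm tvec) \<Rightarrow> bool" where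
  "vector_field_on A U X \<longleftrightarrow>
     (\<forall>p\<in>U. X p \<in> tangent_space A p) \<and>
     (\<forall>V f. open V \<longrightarrow> V \<subseteq> U \<longrightarrow> smooth_on A V f \<longrightarrow> smooth_on A V (\<lambda>p. X p f))"

definition one_form_on ::
  "('m::topological_space, 'e::real_inner) atlas \<Rightarrow> 'm set \<Rightarrow> ('m \<Rightarrow> 'm covec) \<Rightarrow> bool" where
  "one_form_on A U \<xi> \<longleftrightarrow>
     (\<forall>p\<in>U. \<xi> p \<in> cotangent_space A p) \<and>
     (\<forall>V Y. open V \<longrightarrow> V \<subseteq> U \<longrightarrow> vector_field_on A V Y \<longrightarrow> smooth_on A V (\<lambda>p. \<xi> p (Y p)))"

type_synonym 'm form3 = "'m \<Rightarrow> 'm tvec \<Rightarrow> 'm tvec \<Rightarrow> 'm tvec \<Rightarrow> real"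

text \<open>Linearity is required in the first argument only; antisymmetry gives the other two.\<close>

definition three_form :: "('m::topological_space, 'e::real_inner) atlas \<Rightarrow> 'm form3 \<Rightarrow> bool" where
  "three_form A H \<longleftrightarrow>
     (\<forall>p. \<forall>v\<in>tangent_space A p. \<forall>w\<in>tangent_space A p.
        (\<lambda>u. H p u v w) \<in> cotangent_space A p) \<and>
     (\<forall>p u v w. H p u v w \<noteq> 0 \<longrightarrow>
        u \<in> tangent_space A p \<and> v \<in> tangent_space A p \<and> w \<in> tangent_space A p) \<and>
     (\<forall>p u v w. H p v u w = - H p u v w \<and> H p u w v = - H p u v w) \<and>
     (\<forall>V X Y Z. open V \<longrightarrow> vector_field_on A V X \<longrightarrow> vector_field_on A V Y \<longrightarrow>
        vector_field_on A V Z \<longrightarrow> smooth_on A V (\<lambda>p. H p (X p) (Y p) (Z p)))"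

section \<open>Cartan calculus\<close>

definition lie_bracket ::
  "('m::topological_space, 'e::real_inner) atlas \<Rightarrow> ('m \<Rightarrow> 'm tvec) \<Rightarrow> ('m \<Rightarrow> 'm tvec) \<Rightarrow>
     'm \<Rightarrow> 'm tvec" where
  "lie_bracket A X Y p f =
     (if smooth_near A p f then X p (\<lambda>q. Y q f) - Y p (\<lambda>q. X q f) else 0)"

definition differential ::
  "('m::topological_space, 'e::real_inner) atlas \<Rightarrow> ('m \<Rightarrow> real) \<Rightarrow> 'm \<Rightarrow> 'm covec" where
  "differential A f p v = (if v \<in> tangent_space A p then v f else 0)"

definition contract1 :: "('m \<Rightarrow> 'm tvec) \<Rightarrow> ('m \<Rightarrow> 'm covec) \<Rightarrow> 'm \<Rightarrow> real" where
  "contract1 X \<eta> p = \<eta> p (X p)"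

definition contract3 :: "('m \<Rightarrow> 'm tvec) \<Rightarrow> 'm form3 \<Rightarrow> 'm \<Rightarrow> 'm tvec \<Rightarrow> 'm tvec \<Rightarrow> real" where
  "contract3 X H p v w = H p (X p) v w"

text \<open>The Lie derivative of a 1-form, $(\mathcal{L}_X\eta)(Y) = X(\eta(Y)) - \eta([X,Y])$.  Its
  value on a tangent vector \<open>v\<close> at \<open>p\<close> is computed with a vector field \<open>Y\<close> that is defined near
  \<open>p\<close> and has the value \<open>v\<close> at \<open>p\<close>; the result does not depend on the choice of \<open>Y\<close>.\<close>

definition local_extension ::
  "('m::topological_space, 'e::real_inner) atlas \<Rightarrow> 'm \<Rightarrow> 'm tvec \<Rightarrow> 'm \<Rightarrow> 'm tvec" where
  "local_extension A p v =
     (SOME Y. (\<exists>U. open U \<and> p \<in> U \<and> vector_field_on A U Y) \<and> Y p = v)"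

definition lie_derivative1 ::
  "('m::topological_space, 'e::real_inner) atlas \<Rightarrow> ('m \<Rightarrow> 'm tvec) \<Rightarrow> ('m \<Rightarrow> 'm covec) \<Rightarrow>
     'm \<Rightarrow> 'm covec" where
  "lie_derivative1 A X \<eta> p v =
     (if v \<in> tangent_space A p
      then let Y = local_extension A p v
           in X p (\<lambda>q. \<eta> q (Y q)) - \<eta> p (lie_bracket A X Y p)
      else 0)"

text \<open>The invariant formula for \<open>dH\<close>.  In the closedness condition it is applied to vector fields
  on arbitrary open sets, i.e. to the restrictions of \<open>H\<close>.\<close>

definition ext_deriv3 ::
  "('m::topological_space, 'e::real_inner) atlas \<Rightarrow> 'm form3 \<Rightarrow> ('m \<Rightarrow> 'm tvec) \<Rightarrow>
     ('m \<Rightarrow> 'm tvec) \<Rightarrow> ('m \<Rightarrow> 'm tvec) \<Rightarrow> ('m \<Rightarrow> 'm tvec) \<Rightarrow> 'm \<Rightarrow> real" where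
  "ext_deriv3 A H X0 X1 X2 X3 p =
       X0 p (\<lambda>q. H q (X1 q) (X2 q) (X3 q))
     - X1 p (\<lambda>q. H q (X0 q) (X2 q) (X3 q))
     + X2 p (\<lambda>q. H q (X0 q) (X1 q) (X3 q))
     - X3 p (\<lambda>q. H q (X0 q) (X1 q) (X2 q))
     - H p (lie_bracket A X0 X1 p) (X2 p) (X3 p)
     + H p (lie_bracket A X0 X2 p) (X1 p) (X3 p)
     - H p (lie_bracket A X0 X3 p) (X1 p) (X2 p)
     - H p (lie_bracket A X1 X2 p) (X0 p) (X3 p)
     + H p (lie_bracket A X1 X3 p) (X0 p) (X2 p)
     - H p (lie_bracket A X2 X3 p) (X0 p) (X1 p)"

definition closed_three_form ::
  "('m::topological_space, 'e::real_inner) atlas \<Rightarrow> 'm form3 \<Rightarrow> bool" where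
  "closed_three_form A H \<longleftrightarrow> three_form A H \<and>
     (\<forall>U X0 X1 X2 X3. open U \<longrightarrow> vector_field_on A U X0 \<longrightarrow> vector_field_on A U X1 \<longrightarrow>
        vector_field_on A U X2 \<longrightarrow> vector_field_on A U X3 \<longrightarrow>
        (\<forall>p\<in>U. ext_deriv3 A H X0 X1 X2 X3 p = 0))"

section \<open>Twisted Dirac structures\<close>

text \<open>Elements of the fibre of the generalized tangent bundle are pairs of a vector and a
  covector; a section is a pair of a vector field and a 1-form.\<close>

definition gen_tangent_space ::
  "('m::topological_space, 'e::real_inner) atlas \<Rightarrow> 'm \<Rightarrow> ('m tvec \<times> 'm covec) set" where
  "gen_tangent_space A p = tangent_space A p \<times> cotangent_space A p"

definition lincomb :: "nat \<Rightarrow> (nat \<Rightarrow> real) \<Rightarrow> (nat \<Rightarrow> 'm tvec \<times> 'm covec) \<Rightarrow> 'm tvec \<times> 'm covec" where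
  "lincomb r c e = ((\<lambda>f. \<Sum>i<r. c i * fst (e i) f), (\<lambda>v. \<Sum>i<r. c i * snd (e i) v))"

definition gen_subspace ::
  "('m::topological_space, 'e::real_inner) atlas \<Rightarrow> 'm \<Rightarrow> ('m tvec \<times> 'm covec) set \<Rightarrow> bool" where
  "gen_subspace A p W \<longleftrightarrow> W \<subseteq> gen_tangent_space A p \<and>
     (\<lambda>_. 0, \<lambda>_. 0) \<in> W \<and>
     (\<forall>u \<alpha> v \<beta>. (u, \<alpha>) \<in> W \<longrightarrow> (v, \<beta>) \<in> W \<longrightarrow> (\<lambda>f. u f + v f, \<lambda>w. \<alpha> w + \<beta> w) \<in> W) \<and>
     (\<forall>c u \<alpha>. (u, \<alpha>) \<in> W \<longrightarrow> (\<lambda>f. c * u f, \<lambda>w. c * \<alpha> w) \<in> W)"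

definition pairing :: "'m tvec \<times> 'm covec \<Rightarrow> 'm tvec \<times> 'm covec \<Rightarrow> real" where
  "pairing = (\<lambda>(u, \<alpha>) (v, \<beta>). (\<alpha> v + \<beta> u) / 2)"

definition isotropic :: "('m tvec \<times> 'm covec) set \<Rightarrow> bool" where
  "isotropic W \<longleftrightarrow> (\<forall>a\<in>W. \<forall>b\<in>W. pairing a b = 0)"

definition maximally_isotropic ::
  "('m::topological_space, 'e::real_inner) atlas \<Rightarrow> 'm \<Rightarrow> ('m tvec \<times> 'm covec) set \<Rightarrow> bool" where
  "maximally_isotropic A p W \<longleftrightarrow> gen_subspace A p W \<and> isotropic W \<and>
     (\<forall>W'. gen_subspace A p W' \<longrightarrow> isotropic W' \<longrightarrow> W \<subseteq> W' \<longrightarrow> W' = W)"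

definition gen_section_on ::
  "('m::topological_space, 'e::real_inner) atlas \<Rightarrow> 'm set \<Rightarrow>
     ('m \<Rightarrow> 'm tvec) \<times> ('m \<Rightarrow> 'm covec) \<Rightarrow> bool" where
  "gen_section_on A U = (\<lambda>(X, \<xi>). vector_field_on A U X \<and> one_form_on A U \<xi>)"

text \<open>Local triviality is expressed by smooth local frames of a fixed rank \<open>r\<close>.\<close>

definition smooth_subbundle ::
  "('m::topological_space, 'e::real_inner) atlas \<Rightarrow> ('m \<Rightarrow> ('m tvec \<times> 'm covec) set) \<Rightarrow> bool" where
  "smooth_subbundle A L \<longleftrightarrow>
     (\<forall>p. gen_subspace A p (L p)) \<and>
     (\<exists>r. \<forall>p. \<exists>U X \<xi>. open U \<and> p \<in> U \<and> (\<forall>i<r. gen_section_on A U (X i, \<xi> i)) \<and>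
        (\<forall>q\<in>U. L q = {lincomb r c (\<lambda>i. (X i q, \<xi> i q)) | c. True} \<and>
           (\<forall>c. lincomb r c (\<lambda>i. (X i q, \<xi> i q)) = (\<lambda>_. 0, \<lambda>_. 0) \<longrightarrow> (\<forall>i<r. c i = 0))))"

definition sections ::
  "('m::topological_space, 'e::real_inner) atlas \<Rightarrow> ('m \<Rightarrow> ('m tvec \<times> 'm covec) set) \<Rightarrow>
     (('m \<Rightarrow> 'm tvec) \<times> ('m \<Rightarrow> 'm covec)) set" where
  "sections A L = {(X, \<xi>). gen_section_on A UNIV (X, \<xi>) \<and> (\<forall>p. (X p, \<xi> p) \<in> L p)}"

definition courant_bracket ::
  "('m::topological_space, 'e::real_inner) atlas \<Rightarrow>
     ('m \<Rightarrow> 'm tvec) \<times> ('m \<Rightarrow> 'm covec) \<Rightarrow> ('m \<Rightarrow> 'm tvec) \<times> ('m \<Rightarrow> 'm covec) \<Rightarrow>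
     ('m \<Rightarrow> 'm tvec) \<times> ('m \<Rightarrow> 'm covec)" where
  "courant_bracket A = (\<lambda>(X, \<xi>) (Y, \<eta>).
     (lie_bracket A X Y,
      \<lambda>p v. lie_derivative1 A X \<eta> p v - lie_derivative1 A Y \<xi> p v
        - 1 / 2 * differential A (\<lambda>q. contract1 X \<eta> q - contract1 Y \<xi> q) p v))"

definition twisted_courant_bracket ::
  "('m::topological_space, 'e::real_inner) atlas \<Rightarrow> 'm form3 \<Rightarrow>
     ('m \<Rightarrow> 'm tvec) \<times> ('m \<Rightarrow> 'm covec) \<Rightarrow> ('m \<Rightarrow> 'm tvec) \<times> ('m \<Rightarrow> 'm covec) \<Rightarrow>
     ('m \<Rightarrow> 'm tvec) \<times> ('m \<Rightarrow> 'm covec)" where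
  "twisted_courant_bracket A H a b =
     (fst (courant_bracket A a b),
      \<lambda>p v. snd (courant_bracket A a b) p v - H p (fst a p) (fst b p) v)"

definition twisted_dirac ::
  "('m::topological_space, 'e::real_inner) atlas \<Rightarrow> 'm form3 \<Rightarrow>
     ('m \<Rightarrow> ('m tvec \<times> 'm covec) set) \<Rightarrow> bool" where
  "twisted_dirac A H L \<longleftrightarrow> smooth_subbundle A L \<and>
     (\<forall>p. maximally_isotropic A p (L p)) \<and>
     (\<forall>a\<in>sections A L. \<forall>b\<in>sections A L. twisted_courant_bracket A H a b \<in> sections A L)"

section \<open>Admissible functions and Poisson algebras\<close>

text \<open>\<open>X\<close> is not unique; on admissible functions \<open>bracket\<close> does not depend on the one chosen.
  The condition $d(df) + \iota_{X_f} H = 0$ is written as $\iota_{X_f} H = 0$, as $d \circ d = 0$.\<close>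

definition hamiltonian_vf ::
  "('m::topological_space, 'e::real_inner) atlas \<Rightarrow> 'm form3 \<Rightarrow>
     ('m \<Rightarrow> ('m tvec \<times> 'm covec) set) \<Rightarrow> ('m \<Rightarrow> real) \<Rightarrow> ('m \<Rightarrow> 'm tvec) \<Rightarrow> bool" where
  "hamiltonian_vf A H L f X \<longleftrightarrow> vector_field_on A UNIV X \<and>
     (X, differential A f) \<in> sections A L \<and> contract3 X H = (\<lambda>p v w. 0)"

definition admissible ::
  "('m::topological_space, 'e::real_inner) atlas \<Rightarrow> 'm form3 \<Rightarrow>
     ('m \<Rightarrow> ('m tvec \<times> 'm covec) set) \<Rightarrow> ('m \<Rightarrow> real) set" where
  "admissible A H L = {f. smooth_on A UNIV f \<and> (\<exists>X. hamiltonian_vf A H L f X)}"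

definition bracket ::
  "('m::topological_space, 'e::real_inner) atlas \<Rightarrow> 'm form3 \<Rightarrow>
     ('m \<Rightarrow> ('m tvec \<times> 'm covec) set) \<Rightarrow> ('m \<Rightarrow> real) \<Rightarrow> ('m \<Rightarrow> real) \<Rightarrow> 'm \<Rightarrow> real" where
  "bracket A H L f g p = (SOME X. hamiltonian_vf A H L f X) p g"

text \<open>A set \<open>S\<close> of real functions which, with pointwise operations and the bracket \<open>br\<close>, is a
  real Poisson algebra.  Associativity, commutativity and distributivity hold automatically
  for pointwise operations, so only closure has to be required of the algebra structure.\<close>

definition poisson_algebra ::
  "('m \<Rightarrow> real) set \<Rightarrow> (('m \<Rightarrow> real) \<Rightarrow> ('m \<Rightarrow> real) \<Rightarrow> 'm \<Rightarrow> real) \<Rightarrow> bool" where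
  "poisson_algebra S br \<longleftrightarrow>
     (\<lambda>_. 0) \<in> S \<and> (\<lambda>_. 1) \<in> S \<and>
     (\<forall>f\<in>S. \<forall>g\<in>S. (\<lambda>x. f x + g x) \<in> S) \<and>
     (\<forall>c. \<forall>f\<in>S. (\<lambda>x. c * f x) \<in> S) \<and>
     (\<forall>f\<in>S. \<forall>g\<in>S. (\<lambda>x. f x * g x) \<in> S) \<and>
     (\<forall>f\<in>S. \<forall>g\<in>S. br f g \<in> S) \<and>
     (\<forall>f\<in>S. \<forall>g\<in>S. \<forall>h\<in>S. br (\<lambda>x. f x + g x) h = (\<lambda>x. br f h x + br g h x)) \<and>
     (\<forall>f\<in>S. \<forall>g\<in>S. \<forall>h\<in>S. br f (\<lambda>x. g x + h x) = (\<lambda>x. br f g x + br f h x)) \<and>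
     (\<forall>c. \<forall>f\<in>S. \<forall>g\<in>S. br (\<lambda>x. c * f x) g = (\<lambda>x. c * br f g x)) \<and>
     (\<forall>c. \<forall>f\<in>S. \<forall>g\<in>S. br f (\<lambda>x. c * g x) = (\<lambda>x. c * br f g x)) \<and>
     (\<forall>f\<in>S. \<forall>g\<in>S. br f g = (\<lambda>x. - br g f x)) \<and>
     (\<forall>f\<in>S. \<forall>g\<in>S. \<forall>h\<in>S. \<forall>x. br f (br g h) x + br g (br h f) x + br h (br f g) x = 0) \<and>
     (\<forall>f\<in>S. \<forall>g\<in>S. \<forall>h\<in>S. br f (\<lambda>x. g x * h x) = (\<lambda>x. br f g x * h x + g x * br f h x))"

end

theory Submission
  imports Defs
begin

text \<open>Let \<open>X\<close> and \<open>Y\<close> be Hamiltonian vector fields of \<open>f\<close> and \<open>g\<close>.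

  Isotropy of \<open>L\<close> says \<open>X g = - Y f\<close>.  So the bracket is skew and does not depend on the
  choice of \<open>X\<close>, and it is a derivation in its second argument since \<open>X\<close> is one.  Because
  the fibres of \<open>L\<close> are linear and \<open>d(f g) = g df + f dg\<close>, the field \<open>g X + f Y\<close> is Hamiltonian
  for \<open>f g\<close>, and sums and multiples are treated alike (\<open>hamiltonian_combination\<close>).

  The bracket \<open>X g\<close> has the Hamiltonian vector field \<open>[X, Y]\<close> (\<open>hamiltonian_lie_bracket\<close>).
  Indeed \<open>\<L>\<^sub>X dg = d(X g)\<close> and \<open>\<iota>\<^sub>X H = 0\<close> reduce the twisted Courant bracket of \<open>(X, df)\<close> and
  \<open>(Y, dg)\<close> to \<open>([X, Y], d(X g))\<close>, which is again a section of \<open>L\<close>; and \<open>\<iota>\<^bsub>[X,Y]\<^esub> H = 0\<close> is what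
  remains of \<open>dH(X, Y, Z, W) = 0\<close> when \<open>\<iota>\<^sub>X H = \<iota>\<^sub>Y H = 0\<close>.  The Jacobi identity then is the
  definition \<open>[X, Y] h = X (Y h) - Y (X h)\<close>.

  Both the formula for \<open>\<L>\<^sub>X dg\<close> and the pointwise use of \<open>dH = 0\<close> evaluate forms on vector fields
  with prescribed values at a point.  Since tangent vectors are derivations of germs, one needs
  that every derivation at \<open>p\<close> extends to a vector field near \<open>p\<close> (\<open>tangent_extension\<close>).  That
  is the analytic part: by Hadamard's lemma a derivation is a combination of the coordinate
  derivations, and these extend with constant coefficients.  Hadamard's lemma requires that the
  averages \<open>\<integral> t ^ m * F (c + t (y - c)) dt\<close> over \<open>0 \<le> t \<le> 1\<close> of a smooth function are smooth in
  \<open>y\<close> (\<open>Cinf_on_radial_average\<close>).\<close>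

section \<open>Calculus of smooth functions\<close>

lemma Ck_on_cong_imp:
  assumes "open S" "\<And>x. x \<in> S \<Longrightarrow> f x = g x" "Ck_on k S f"
  shows "Ck_on k S g"
  using assms(2,3)
proof (induction k arbitrary: f g)
  case 0
  then show ?case by (simp cong: continuous_on_cong)
next
  case (Suc k)
  have fd: "frechet_derivative f (at x) = frechet_derivative g (at x)" if "x \<in> S" for x
    using Suc.prems that assms(1) by (intro frechet_derivative_transform_within_open[of f x S]) auto
  have "g differentiable (at x)" if "x \<in> S" for x
    using Suc.prems that assms(1) has_derivative_transform_within_open[of f _ x UNIV S g]
    unfolding differentiable_def by (metis Ck_on.simps(2) differentiable_def)
  moreover have "Ck_on k S (\<lambda>x. frechet_derivative g (at x) v)" for v
    by (rule Suc.IH[of "\<lambda>x. frechet_derivative f (at x) v"]) (use Suc.prems fd in auto)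
  ultimately show ?case by simp
qed

lemma Ck_on_SucD: "Ck_on (Suc k) S f \<Longrightarrow> Ck_on k S f"
proof (induction k arbitrary: f)
  case 0
  then show ?case
    by (auto intro!: continuous_at_imp_continuous_on differentiable_imp_continuous_within)
qed auto

lemma Ck_on_subset: "Ck_on k S f \<Longrightarrow> T \<subseteq> S \<Longrightarrow> Ck_on k T f"
  by (induction k arbitrary: f) (auto intro: continuous_on_subset)

lemma Ck_on_const: "Ck_on k S (\<lambda>x. c)"
  by (induction k arbitrary: c) auto

lemma Ck_on_add:
  assumes "open S" "Ck_on k S f" "Ck_on k S g"
  shows "Ck_on k S (\<lambda>x. f x + g x)"
  using assms(2,3)
proof (induction k arbitrary: f g)
  case 0
  then show ?case by (auto intro: continuous_intros)
next
  case (Suc k)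
  have "frechet_derivative (\<lambda>x. f x + g x) (at x) v =
      frechet_derivative f (at x) v + frechet_derivative g (at x) v" if "x \<in> S" for x v
    using Suc.prems that
    by (subst frechet_derivative_at[symmetric, OF has_derivative_add])
       (auto simp flip: frechet_derivative_works)
  then have "Ck_on k S (\<lambda>x. frechet_derivative (\<lambda>x. f x + g x) (at x) v)" for v
    by (rule Ck_on_cong_imp[OF assms(1) sym]) (use Suc in auto)
  then show ?case using Suc.prems by auto
qed

lemma Ck_on_mult:
  fixes f g :: "'a::real_normed_vector \<Rightarrow> real"
  assumes "open S" "Ck_on k S f" "Ck_on k S g"
  shows "Ck_on k S (\<lambda>x. f x * g x)"
  using assms(2,3)
proof (induction k arbitrary: f g)
  case 0
  then show ?case by (auto intro: continuous_intros)
next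
  case (Suc k)
  have "frechet_derivative (\<lambda>x. f x * g x) (at x) v =
      f x * frechet_derivative g (at x) v + frechet_derivative f (at x) v * g x" if "x \<in> S" for x v
    using Suc.prems that
    by (subst frechet_derivative_at[symmetric, OF has_derivative_mult])
       (auto simp flip: frechet_derivative_works)
  then have "Ck_on k S (\<lambda>x. frechet_derivative (\<lambda>x. f x * g x) (at x) v)" for v
    by (rule Ck_on_cong_imp[OF assms(1) sym])
       (use Suc Ck_on_SucD[OF Suc.prems(1)] Ck_on_SucD[OF Suc.prems(2)] in
         \<open>auto intro!: Ck_on_add[OF assms(1)]\<close>)
  then show ?case using Suc.prems by auto
qed

lemma Ck_on_sum:
  assumes "open S" "finite I" "\<And>i. i \<in> I \<Longrightarrow> Ck_on k S (f i)"
  shows "Ck_on k S (\<lambda>x. \<Sum>i\<in>I. f i x)"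
  using assms(2,3)
  by (induction I rule: finite_induct) (auto intro: Ck_on_const Ck_on_add[OF assms(1)])

lemma Ck_on_bounded_linear:
  assumes "open S" "bounded_linear l" "Ck_on k S f"
  shows "Ck_on k S (\<lambda>x. l (f x))"
  using assms(3)
proof (induction k arbitrary: f)
  case 0
  then show ?case using bounded_linear.continuous_on[OF assms(2)] by auto
next
  case (Suc k)
  have d: "((\<lambda>x. l (f x)) has_derivative (\<lambda>v. l (frechet_derivative f (at x) v))) (at x)"
    if "x \<in> S" for x
    using Suc.prems that
    by (intro bounded_linear.has_derivative[OF assms(2)]) (auto simp flip: frechet_derivative_works)
  have "Ck_on k S (\<lambda>x. frechet_derivative (\<lambda>x. l (f x)) (at x) v)" for v
    by (rule Ck_on_cong_imp[OF assms(1), of "\<lambda>x. l (frechet_derivative f (at x) v)"])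
       (use Suc frechet_derivative_at[OF d] in \<open>auto dest: fun_cong\<close>)
  then show ?case using d unfolding differentiable_def by (auto simp: differentiable_def)
qed

text \<open>A finite family whose coordinate functionals \<open>x \<bullet> b\<close> reconstruct every vector replaces the
  basis of sort \<open>euclidean_space\<close>, which the model space need not have.\<close>

definition parseval_frame :: "'a::real_inner set \<Rightarrow> bool" where
  "parseval_frame E \<longleftrightarrow> finite E \<and> (\<forall>x. (\<Sum>b\<in>E. (x \<bullet> b) *\<^sub>R b) = x)"

text \<open>Gram-Schmidt orthogonalization of a spanning set, followed by normalization.\<close>

lemma parseval_frame_exists:
  fixes B :: "'a::real_inner set"
  assumes "finite B" "span B = UNIV"
  obtains E :: "'a set" where "parseval_frame E"
proof -
  obtain C :: "'a set" where C: "finite C" "span C = UNIV" "pairwise orthogonal C"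
    using basis_orthogonal[OF assms(1)] assms(2) by metis
  define E where "E = (\<lambda>c. c /\<^sub>R norm c) ` (C - {0})"
  have fin: "finite E" using C(1) by (simp add: E_def)
  have "C \<subseteq> span E"
  proof
    fix c assume "c \<in> C"
    show "c \<in> span E"
    proof (cases "c = 0")
      case False
      then have "c /\<^sub>R norm c \<in> span E" using \<open>c \<in> C\<close> by (auto simp: E_def intro!: span_base)
      from span_scale[OF this, of "norm c"] False show ?thesis by simp
    qed (simp add: span_zero)
  qed
  then have "span E = UNIV" using C(2) by (metis span_minimal subspace_span top.extremum_uniqueI)
  moreover have "pairwise orthogonal E"
    using C(3) unfolding E_def pairwise_def by (auto simp: orthogonal_def)
  moreover have "norm i = 1" if i: "i \<in> E" for i
  proof -
    obtain c where "c \<noteq> 0" "i = c /\<^sub>R norm c" using i by (auto simp: E_def)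
    then show ?thesis by simp
  qed
  ultimately have "parseval_frame E"
    unfolding parseval_frame_def using fin by (auto intro: orthonormal_basis_expand)
  then show ?thesis by (rule that)
qed

lemma linear_parseval_expand:
  assumes "parseval_frame E" "linear l"
  shows "l h = (\<Sum>b\<in>E. (h \<bullet> b) *\<^sub>R l b)"
proof -
  have "l h = l (\<Sum>b\<in>E. (h \<bullet> b) *\<^sub>R b)"
    using assms(1) unfolding parseval_frame_def by metis
  then show ?thesis using assms(2) by (simp add: linear_sum linear_scale)
qed

lemma frechet_parseval_expand:
  fixes f :: "'a::real_inner \<Rightarrow> real"
  assumes "parseval_frame (E :: 'a set)" "f differentiable at x"
  shows "frechet_derivative f (at x) h = (\<Sum>b\<in>E. (h \<bullet> b) * frechet_derivative f (at x) b)"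
  by (rule linear_parseval_expand[OF assms(1) linear_frechet_derivative[OF assms(2)],
      unfolded real_scaleR_def])

lemma Cinf_on_cong_imp:
  "open S \<Longrightarrow> (\<And>x. x \<in> S \<Longrightarrow> f x = g x) \<Longrightarrow> Cinf_on S f \<Longrightarrow> Cinf_on S g"
  unfolding Cinf_on_def using Ck_on_cong_imp by blast

lemma Cinf_on_subset: "Cinf_on S f \<Longrightarrow> T \<subseteq> S \<Longrightarrow> Cinf_on T f"
  unfolding Cinf_on_def using Ck_on_subset by blast

lemma Cinf_on_differentiable: "Cinf_on S f \<Longrightarrow> x \<in> S \<Longrightarrow> f differentiable at x"
  unfolding Cinf_on_def by (metis Ck_on.simps(2))

lemma Cinf_on_derivative: "Cinf_on S f \<Longrightarrow> Cinf_on S (\<lambda>x. frechet_derivative f (at x) v)"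
  unfolding Cinf_on_def by (metis Ck_on.simps(2))

lemma Cinf_on_continuous: "Cinf_on S f \<Longrightarrow> continuous_on S f"
  unfolding Cinf_on_def by (metis Ck_on.simps(1))

lemma Cinf_on_const: "Cinf_on S (\<lambda>x. c)"
  unfolding Cinf_on_def by (simp add: Ck_on_const)

lemma Cinf_on_add:
  "open S \<Longrightarrow> Cinf_on S f \<Longrightarrow> Cinf_on S g \<Longrightarrow> Cinf_on S (\<lambda>x. f x + g x)"
  unfolding Cinf_on_def by (simp add: Ck_on_add)

lemma Cinf_on_mult:
  fixes f g :: "'a::real_normed_vector \<Rightarrow> real"
  shows "open S \<Longrightarrow> Cinf_on S f \<Longrightarrow> Cinf_on S g \<Longrightarrow> Cinf_on S (\<lambda>x. f x * g x)"
  unfolding Cinf_on_def by (simp add: Ck_on_mult)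

lemma Cinf_on_id: "Cinf_on S (\<lambda>x. x)"
proof -
  have "Ck_on k S (\<lambda>x. x)" for k
    by (cases k) (auto simp: Ck_on_const frechet_derivative_ident)
  then show ?thesis by (simp add: Cinf_on_def)
qed

lemma Cinf_on_bounded_linear:
  "open S \<Longrightarrow> bounded_linear l \<Longrightarrow> Cinf_on S f \<Longrightarrow> Cinf_on S (\<lambda>x. l (f x))"
  unfolding Cinf_on_def by (simp add: Ck_on_bounded_linear)

text \<open>By the chain rule the derivatives of \<open>F \<circ> T\<close> are sums of products of a derivative of a
  coordinate of \<open>T\<close> with a function \<open>(\<partial>\<^sub>b F) \<circ> T\<close> of the same shape, to which the induction
  applies.\<close>

lemma Cinf_on_compose:
  fixes F :: "'e::real_inner \<Rightarrow> real" and T :: "'a::real_normed_vector \<Rightarrow> 'e"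
  assumes E: "parseval_frame (E :: 'e set)" and S: "open S" and TW: "T ` S \<subseteq> W"
    and F: "Cinf_on W F" and T: "Cinf_on S T"
  shows "Cinf_on S (\<lambda>x. F (T x))"
proof -
  have "Ck_on k S (\<lambda>x. F (T x))" for k
    using F
  proof (induction k arbitrary: F)
    case 0
    then show ?case
      using continuous_on_compose2[OF Cinf_on_continuous Cinf_on_continuous[OF T] TW] by simp
  next
    case (Suc k)
    have d: "((\<lambda>x. F (T x)) has_derivative
        (\<lambda>v. frechet_derivative F (at (T x)) (frechet_derivative T (at x) v))) (at x)"
      if "x \<in> S" for x
      using Cinf_on_differentiable[OF T that] Cinf_on_differentiable[OF Suc.prems, of "T x"] TW that
      by (intro has_derivative_compose[of T _ x UNIV F]) (auto simp flip: frechet_derivative_works)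
    have "Ck_on k S (\<lambda>x. frechet_derivative (\<lambda>x. F (T x)) (at x) v)" for v
    proof (rule Ck_on_cong_imp[OF S])
      fix x assume "x \<in> S"
      have "frechet_derivative (\<lambda>x. F (T x)) (at x) v =
          frechet_derivative F (at (T x)) (frechet_derivative T (at x) v)"
        using frechet_derivative_at[OF d[OF \<open>x \<in> S\<close>]] by metis
      also have "\<dots> = (\<Sum>b\<in>E. (frechet_derivative T (at x) v \<bullet> b) *
          frechet_derivative F (at (T x)) b)"
        using TW \<open>x \<in> S\<close> by (intro frechet_parseval_expand E Cinf_on_differentiable[OF Suc.prems]) auto
      finally show "(\<Sum>b\<in>E. (frechet_derivative T (at x) v \<bullet> b) *
          frechet_derivative F (at (T x)) b) = frechet_derivative (\<lambda>x. F (T x)) (at x) v" ..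
    next
      show "Ck_on k S (\<lambda>x. \<Sum>b\<in>E. (frechet_derivative T (at x) v \<bullet> b) *
          frechet_derivative F (at (T x)) b)"
      proof (intro Ck_on_sum Ck_on_mult S)
        show "finite E" using E by (simp add: parseval_frame_def)
        show "Ck_on k S (\<lambda>x. frechet_derivative T (at x) v \<bullet> b)" for b
          using Cinf_on_derivative[OF T, of v] unfolding Cinf_on_def
          by (intro Ck_on_bounded_linear[OF S bounded_linear_inner_left]) auto
        show "Ck_on k S (\<lambda>x. frechet_derivative F (at (T x)) b)" for b
          by (rule Suc.IH[OF Cinf_on_derivative[OF Suc.prems]])
      qed
    qed
    then show ?case using d by (auto simp: differentiable_def)
  qed
  then show ?thesis by (simp add: Cinf_on_def)
qed

section \<open>Hadamard's lemma\<close>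

lemma radial_point_in_ball:
  fixes c :: "'e::real_inner"
  assumes "y \<in> ball c r" "t \<in> {0..1::real}"
  shows "c + t *\<^sub>R (y - c) \<in> ball c r"
proof -
  have "norm (t *\<^sub>R (y - c)) \<le> norm (y - c)"
    using assms(2) by (simp add: mult_left_le_one_le)
  then show ?thesis using assms(1) by (simp add: dist_norm norm_minus_commute)
qed

lemma radial_continuous_on:
  fixes c :: "'e::real_inner" and F :: "'e \<Rightarrow> real"
  assumes "continuous_on (ball c r) F"
  shows "continuous_on (ball c r \<times> {0..1::real}) (\<lambda>(y, t). F (c + t *\<^sub>R (y - c)))"
  unfolding case_prod_unfold
  by (rule continuous_on_compose2[OF assms])
     (auto intro!: continuous_intros radial_point_in_ball simp del: mem_ball)

lemma radial_integrable:
  fixes c :: "'e::real_inner" and F :: "'e \<Rightarrow> real"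
  assumes "continuous_on (ball c r) F" "y \<in> ball c r"
  shows "(\<lambda>t. t ^ m * F (c + t *\<^sub>R (y - c))) integrable_on {0..1}"
  by (rule integrable_continuous_real)
     (auto intro!: continuous_intros continuous_on_compose2[OF assms(1)] radial_point_in_ball assms
        simp del: mem_ball)

text \<open>Differentiation under the integral sign.  The mean value theorem along the segment from
  \<open>x\<close> to \<open>y\<close> bounds the error of the integrand by the oscillation of the partial derivatives,
  which is uniformly small in \<open>t\<close> because \<open>{0..1}\<close> is compact.\<close>

lemma radial_average_has_derivative:
  fixes c :: "'e::real_inner" and F :: "'e \<Rightarrow> real"
  assumes E: "parseval_frame (E :: 'e set)"
    and diff: "\<And>y. y \<in> ball c r \<Longrightarrow> F differentiable at y"
    and cont: "\<And>v. continuous_on (ball c r) (\<lambda>y. frechet_derivative F (at y) v)"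
    and x: "x \<in> ball c r"
  shows "((\<lambda>y. integral {0..1} (\<lambda>t. t ^ m * F (c + t *\<^sub>R (y - c)))) has_derivative
    (\<lambda>h. integral {0..1} (\<lambda>t. t ^ Suc m * frechet_derivative F (at (c + t *\<^sub>R (x - c))) h))) (at x)"
    (is "(?G has_derivative ?D) (at x)")
proof -
  let ?pt = "\<lambda>y t. c + t *\<^sub>R (y - c)"
  let ?d = "\<lambda>y h. frechet_derivative F (at y) h"
  have finE: "finite E" using E by (simp add: parseval_frame_def)
  have contF: "continuous_on (ball c r) F"
    using diff by (auto intro!: continuous_at_imp_continuous_on differentiable_imp_continuous_within)
  note int = radial_integrable[OF contF]
  note intD = radial_integrable[OF cont x]
  have D: "?D h = (\<Sum>b\<in>E. (h \<bullet> b) * ?D b)" for h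
  proof -
    have "?D h = integral {0..1} (\<lambda>t. \<Sum>b\<in>E. (h \<bullet> b) * (t ^ Suc m * ?d (?pt x t) b))"
    proof (rule integral_cong)
      fix t :: real assume "t \<in> {0..1}"
      then have "?d (?pt x t) h = (\<Sum>b\<in>E. (h \<bullet> b) * ?d (?pt x t) b)"
        by (intro frechet_parseval_expand E diff radial_point_in_ball x)
      then show "t ^ Suc m * ?d (?pt x t) h = (\<Sum>b\<in>E. (h \<bullet> b) * (t ^ Suc m * ?d (?pt x t) b))"
        by (simp add: sum_distrib_left algebra_simps)
    qed
    also have "\<dots> = (\<Sum>b\<in>E. integral {0..1} (\<lambda>t. (h \<bullet> b) * (t ^ Suc m * ?d (?pt x t) b)))"
      by (rule integral_sum) (use finE intD integrable_on_mult_right in blast)+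
    finally show ?thesis by simp
  qed
  have blD: "bounded_linear ?D"
  proof -
    have expand: "?D = (\<lambda>h. \<Sum>b\<in>E. (h \<bullet> b) * ?D b)" by (rule ext) (rule D)
    show ?thesis
      by (rule ssubst[where P = bounded_linear, OF expand])
         (rule bounded_linear_sum, rule bounded_linear_mult_const, rule bounded_linear_inner_left)
  qed
  show ?thesis
    unfolding has_derivative_at_alt
  proof (intro conjI blD allI impI)
    fix e :: real assume e: "0 < e"
    \<comment> \<open>In dimension 0 the frame may be empty and \<open>N = 0\<close>, hence the denominator \<open>N + 1\<close>.\<close>
    define N where "N = (\<Sum>b\<in>E. norm b)"
    have N: "N \<ge> 0" by (simp add: N_def sum_nonneg)
    define e' where "e' = e / (N + 1)"
    have e': "e' > 0" using e N by (simp add: e'_def)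
    have Ne: "N * e' \<le> e" using e N by (simp add: e'_def field_simps)
    let ?close = "\<lambda>y b. \<forall>t\<in>{0..1}. \<bar>?d (?pt y t) b - ?d (?pt x t) b\<bar> \<le> e'"
    have "\<forall>\<^sub>F y in nhds x. ?close y b" for b
    proof -
      obtain X0 where X0: "x \<in> X0" "open X0"
        "\<forall>y\<in>X0 \<inter> ball c r. \<forall>t\<in>{0..1}. dist (?d (?pt y t) b) (?d (?pt x t) b) \<le> e'"
        using continuous_on_prod_compactE[OF radial_continuous_on[OF cont[of b]] _ x e'] by auto
      show ?thesis
        unfolding eventually_nhds using X0 x
        by (intro exI[of _ "X0 \<inter> ball c r"]) (auto simp: dist_real_def)
    qed
    then have "\<forall>\<^sub>F y in nhds x. \<forall>b\<in>E. ?close y b"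
      using finE by (intro eventually_ball_finite) auto
    moreover have "\<forall>\<^sub>F y in nhds x. y \<in> ball c r"
      using x by (intro eventually_nhds_in_open) auto
    ultimately have "\<forall>\<^sub>F y in nhds x. y \<in> ball c r \<and> (\<forall>b\<in>E. ?close y b)"
      by eventually_elim simp
    then obtain d where d: "d > 0"
      and dW: "\<And>y. dist y x < d \<Longrightarrow> y \<in> ball c r"
      and dE: "\<And>y b t. dist y x < d \<Longrightarrow> b \<in> E \<Longrightarrow> t \<in> {0..1} \<Longrightarrow>
        \<bar>?d (?pt y t) b - ?d (?pt x t) b\<bar> \<le> e'"
      unfolding eventually_nhds_metric by metis
    show "\<exists>d>0. \<forall>y. norm (y - x) < d \<longrightarrow>
        norm (?G y - ?G x - ?D (y - x)) \<le> e * norm (y - x)"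
    proof (intro exI[of _ d] conjI d allI impI)
      fix y assume "norm (y - x) < d"
      then have y: "dist y x < d" by (simp add: dist_norm)
      define h where "h = y - x"
      have bound: "\<bar>F (?pt y t) - F (?pt x t) - t * ?d (?pt x t) h\<bar> \<le> e * norm h"
        if t: "t \<in> {0..1}" for t :: real
      proof -
        define z where "z s = x + s *\<^sub>R h" for s :: real
        have zd: "dist (z s) x < d" if "s \<in> {0..1}" for s
        proof -
          have "norm (s *\<^sub>R h) \<le> norm h" using that by (simp add: mult_left_le_one_le)
          then show ?thesis using y by (simp add: z_def h_def dist_norm)
        qed
        have "((\<lambda>s. F (?pt (z s) t)) has_derivative (\<lambda>u. ?d (?pt (z s) t) (t *\<^sub>R u *\<^sub>R h)))
            (at s within {0..1})" if s: "s \<in> {0..1}" for s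
        proof (rule has_derivative_compose[of "\<lambda>s. ?pt (z s) t" _ s _ F])
          show "((\<lambda>s. ?pt (z s) t) has_derivative (\<lambda>u. t *\<^sub>R u *\<^sub>R h)) (at s within {0..1})"
            unfolding z_def by (auto intro!: derivative_eq_intros)
          show "(F has_derivative ?d (?pt (z s) t)) (at (?pt (z s) t))"
            using diff[OF radial_point_in_ball[OF dW[OF zd[OF s]] t]]
            by (simp add: frechet_derivative_works)
        qed
        then obtain s where s: "s \<in> {0<..<1::real}"
          and "F (?pt (z 1) t) - F (?pt (z 0) t) = ?d (?pt (z s) t) (t *\<^sub>R (1 - 0) *\<^sub>R h)"
          using mvt_simple[of 0 1 "\<lambda>s. F (?pt (z s) t)"
              "\<lambda>s u. ?d (?pt (z s) t) (t *\<^sub>R u *\<^sub>R h)"] by auto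
        moreover have "F differentiable at (?pt (z s) t)" "F differentiable at (?pt x t)"
          using diff[OF radial_point_in_ball[OF dW[OF zd] t]] s
            diff[OF radial_point_in_ball[OF x t]] by auto
        moreover have "z 1 = y" "z 0 = x" by (auto simp: z_def h_def)
        ultimately have "F (?pt y t) - F (?pt x t) - t * ?d (?pt x t) h =
            t * (?d (?pt (z s) t) h - ?d (?pt x t) h)"
          by (simp add: linear_scale[OF linear_frechet_derivative] algebra_simps)
        also have "\<bar>\<dots>\<bar> \<le> \<bar>?d (?pt (z s) t) h - ?d (?pt x t) h\<bar>"
          using t by (simp add: abs_mult mult_left_le_one_le)
        also have "?d (?pt (z s) t) h - ?d (?pt x t) h =
            (\<Sum>b\<in>E. (h \<bullet> b) * (?d (?pt (z s) t) b - ?d (?pt x t) b))"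
          by (subst frechet_parseval_expand[OF E \<open>F differentiable at (?pt (z s) t)\<close>, of h],
              subst frechet_parseval_expand[OF E \<open>F differentiable at (?pt x t)\<close>, of h])
             (simp add: sum_subtractf algebra_simps)
        also have "\<bar>\<dots>\<bar> \<le> (\<Sum>b\<in>E. \<bar>(h \<bullet> b) * (?d (?pt (z s) t) b - ?d (?pt x t) b)\<bar>)"
          by (rule sum_abs)
        also have "\<dots> \<le> (\<Sum>b\<in>E. (norm h * norm b) * e')"
          unfolding abs_mult using s t
          by (intro sum_mono mult_mono Cauchy_Schwarz_ineq2 dE zd) auto
        also have "\<dots> = norm h * (N * e')"
          by (simp add: N_def sum_distrib_left sum_distrib_right mult.assoc)
        also have "\<dots> \<le> norm h * e" by (intro mult_left_mono Ne) auto
        finally show ?thesis by (simp add: mult.commute)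
      qed
      have "((\<lambda>t. t ^ m * F (?pt y t) - t ^ m * F (?pt x t) - t ^ Suc m * ?d (?pt x t) h)
          has_integral (?G y - ?G x - ?D h)) {0..1}"
        by (intro has_integral_diff integrable_integral int dW y x intD)
      then have "((\<lambda>t. t ^ m * (F (?pt y t) - F (?pt x t) - t * ?d (?pt x t) h))
          has_integral (?G y - ?G x - ?D h)) {0..1}"
        by (rule has_integral_eq[rotated]) (simp add: algebra_simps)
      moreover have "norm (t ^ m * (F (?pt y t) - F (?pt x t) - t * ?d (?pt x t) h)) \<le> e * norm h"
        if t: "t \<in> {0..1}" for t :: real
      proof -
        have "\<bar>t ^ m\<bar> \<le> 1" using t by (simp add: power_le_one)
        then show ?thesis
          using mult_mono[OF _ bound[OF t], of "\<bar>t ^ m\<bar>" 1] by (simp add: abs_mult)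
      qed
      ultimately have "norm (?G y - ?G x - ?D h) \<le> e * norm h * measure lborel {0..1::real}"
        using e by (intro has_integral_bound_real[of "e * norm h" "{}"]) simp_all
      then show "norm (?G y - ?G x - ?D (y - x)) \<le> e * norm (y - x)" by (simp add: h_def)
    qed
  qed
qed

text \<open>Differentiating a radial average gives the radial average of a derivative with the weight
  multiplied by \<open>t\<close>; carrying the weight \<open>t ^ m\<close> along makes the induction on the order close.\<close>

lemma Cinf_on_radial_average:
  fixes c :: "'e::real_inner" and F :: "'e \<Rightarrow> real"
  assumes E: "parseval_frame (E :: 'e set)" and F: "Cinf_on (ball c r) F"
  shows "Cinf_on (ball c r) (\<lambda>y. integral {0..1} (\<lambda>t. t ^ m * F (c + t *\<^sub>R (y - c))))"
proof -
  have "Ck_on k (ball c r) (\<lambda>y. integral {0..1} (\<lambda>t. t ^ m * F (c + t *\<^sub>R (y - c))))" for k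
    using F
  proof (induction k arbitrary: F m)
    case (0 F m)
    note d = radial_average_has_derivative[OF E Cinf_on_differentiable[OF 0]
        Cinf_on_continuous[OF Cinf_on_derivative[OF 0]]]
    show ?case
      unfolding Ck_on.simps
      by (intro continuous_at_imp_continuous_on ballI has_derivative_continuous[OF d])
  next
    case (Suc k F m)
    note d = radial_average_has_derivative[OF E Cinf_on_differentiable[OF Suc.prems]
        Cinf_on_continuous[OF Cinf_on_derivative[OF Suc.prems]], where m = m]
    have "Ck_on k (ball c r) (\<lambda>x. frechet_derivative
        (\<lambda>y. integral {0..1} (\<lambda>t. t ^ m * F (c + t *\<^sub>R (y - c)))) (at x) v)" for v
      by (rule Ck_on_cong_imp[OF open_ball _ Suc.IH[OF Cinf_on_derivative[OF Suc.prems], of "Suc m" v]])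
         (rule fun_cong[OF frechet_derivative_at[OF d]])
    then show ?case using differentiableI[OF d] by simp
  qed
  then show ?thesis by (simp add: Cinf_on_def)
qed

text \<open>The fundamental theorem of calculus on the segment from \<open>c\<close> to \<open>y\<close>.\<close>

lemma hadamard_expansion:
  fixes c :: "'e::real_inner" and F :: "'e \<Rightarrow> real"
  assumes E: "parseval_frame (E :: 'e set)" and F: "Cinf_on (ball c r) F" and y: "y \<in> ball c r"
  shows "F y = F c + (\<Sum>b\<in>E. ((y - c) \<bullet> b) *
    integral {0..1} (\<lambda>t. frechet_derivative F (at (c + t *\<^sub>R (y - c))) b))"
proof -
  let ?pt = "\<lambda>t. c + t *\<^sub>R (y - c)"
  let ?d = "\<lambda>t h. frechet_derivative F (at (?pt t)) h"
  have diff: "F differentiable at (?pt t)" if "t \<in> {0..1}" for t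
    using Cinf_on_differentiable[OF F radial_point_in_ball[OF y that]] .
  have "((\<lambda>t. F (?pt t)) has_vector_derivative ?d t (y - c)) (at t within {0..1})"
    if t: "t \<in> {0..1}" for t
  proof -
    have "((\<lambda>t. F (?pt t)) has_derivative (\<lambda>u. ?d t (u *\<^sub>R (y - c)))) (at t within {0..1})"
    proof (rule has_derivative_compose[of ?pt _ t _ F])
      show "(?pt has_derivative (\<lambda>u. u *\<^sub>R (y - c))) (at t within {0..1})"
        by (auto intro!: derivative_eq_intros)
      show "(F has_derivative ?d t) (at (?pt t))"
        using diff[OF t] by (simp add: frechet_derivative_works)
    qed
    then show ?thesis
      unfolding has_vector_derivative_def
      by (simp add: linear_scale[OF linear_frechet_derivative[OF diff[OF t]]])
  qed
  then have 1: "((\<lambda>t. ?d t (y - c)) has_integral (F (?pt 1) - F (?pt 0))) {0..1}"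
    by (intro fundamental_theorem_of_calculus) auto
  have "((\<lambda>t. \<Sum>b\<in>E. ((y - c) \<bullet> b) * ?d t b) has_integral
      (\<Sum>b\<in>E. ((y - c) \<bullet> b) * integral {0..1} (\<lambda>t. ?d t b))) {0..1}"
    using E radial_integrable[OF Cinf_on_continuous[OF Cinf_on_derivative[OF F]] y, of 0]
    by (intro has_integral_sum has_integral_mult_right integrable_integral)
       (auto simp: parseval_frame_def)
  then have 2: "((\<lambda>t. ?d t (y - c)) has_integral
      (\<Sum>b\<in>E. ((y - c) \<bullet> b) * integral {0..1} (\<lambda>t. ?d t b))) {0..1}"
    by (rule has_integral_eq[rotated]) (rule frechet_parseval_expand[OF E diff, symmetric])
  from has_integral_unique[OF 1 2] show ?thesis by simp
qed

section \<open>Smooth functions on a manifold\<close>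

lemma smooth_on_subset: "smooth_on A U f \<Longrightarrow> V \<subseteq> U \<Longrightarrow> smooth_on A V f"
  unfolding smooth_on_def by (fast intro: Cinf_on_subset[OF _ image_mono])

lemma smooth_nearI: "open U \<Longrightarrow> p \<in> U \<Longrightarrow> smooth_on A U f \<Longrightarrow> smooth_near A p f"
  unfolding smooth_near_def by blast

lemma smooth_near_common:
  assumes "smooth_near A p f" "smooth_near A p g"
  obtains U where "open U" "p \<in> U" "smooth_on A U f" "smooth_on A U g"
proof -
  from assms obtain U V where "open U" "p \<in> U" "smooth_on A U f" "open V" "p \<in> V" "smooth_on A V g"
    unfolding smooth_near_def by blast
  then show ?thesis
    by (intro that[of "U \<inter> V"]) (auto elim: smooth_on_subset)
qed

locale smooth_mfd =
  fixes A :: "('m::{t2_space, second_countable_topology}, 'e::real_inner) atlas"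
  assumes manifold: "smooth_manifold A"
begin

lemma model_frame:
  obtains E :: "'e set" where "parseval_frame E"
  using manifold parseval_frame_exists unfolding smooth_manifold_def by metis

lemma chart_at:
  obtains D \<phi> where "(D, \<phi>) \<in> A" "p \<in> D"
proof -
  have "p \<in> (\<Union>(D, \<phi>)\<in>A. D)" using manifold unfolding smooth_manifold_def by simp
  then show ?thesis using that by auto
qed

lemma chart_homeomorphism:
  assumes "(D, \<phi>) \<in> A"
  shows "open D" "open (\<phi> ` D)" "homeomorphism D (\<phi> ` D) \<phi> (inv_into D \<phi>)"
  using manifold assms unfolding smooth_manifold_def by auto

lemma chart_inverse:
  assumes "(D, \<phi>) \<in> A" "q \<in> D"
  shows "inv_into D \<phi> (\<phi> q) = q"
  using chart_homeomorphism(3)[OF assms(1)] assms(2) by (simp add: homeomorphism_def)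

lemma chart_image_open:
  assumes "(D, \<phi>) \<in> A" "open U"
  shows "open (\<phi> ` (D \<inter> U))"
proof -
  have "openin (top_of_set (\<phi> ` D)) (\<phi> ` (D \<inter> U))"
    by (rule homeomorphism_imp_open_map[OF chart_homeomorphism(3)[OF assms(1)]])
       (use assms(2) in \<open>simp add: openin_open_Int\<close>)
  then show ?thesis using chart_homeomorphism(2)[OF assms(1)] openin_open_trans by blast
qed

lemma chart_preimage_open:
  assumes "(D, \<phi>) \<in> A" "open W"
  shows "open (D \<inter> \<phi> -` W)"
  using chart_homeomorphism[OF assms(1)] assms(2)
  by (intro continuous_open_preimage) (auto simp: homeomorphism_def)

lemma smooth_on_cong:
  assumes "open U" "\<And>x. x \<in> U \<Longrightarrow> f x = g x" "smooth_on A U f"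
  shows "smooth_on A U g"
  unfolding smooth_on_def
proof clarify
  fix D \<phi> assume c: "(D, \<phi>) \<in> A"
  show "Cinf_on (\<phi> ` (D \<inter> U)) (g \<circ> inv_into D \<phi>)"
    by (rule Cinf_on_cong_imp[OF chart_image_open[OF c assms(1)], of "f \<circ> inv_into D \<phi>"])
       (use assms c chart_inverse[OF c] in \<open>auto simp: smooth_on_def\<close>)
qed

lemma smooth_on_const: "smooth_on A U (\<lambda>x. c)"
  unfolding smooth_on_def comp_def by (simp add: Cinf_on_const)

lemma smooth_on_add:
  "open U \<Longrightarrow> smooth_on A U f \<Longrightarrow> smooth_on A U g \<Longrightarrow> smooth_on A U (\<lambda>x. f x + g x)"
  unfolding smooth_on_def comp_def by (auto intro!: Cinf_on_add chart_image_open)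

lemma smooth_on_mult:
  "open U \<Longrightarrow> smooth_on A U f \<Longrightarrow> smooth_on A U g \<Longrightarrow> smooth_on A U (\<lambda>x. f x * g x)"
  unfolding smooth_on_def comp_def by (auto intro!: Cinf_on_mult chart_image_open)

lemma smooth_on_cmult: "open U \<Longrightarrow> smooth_on A U f \<Longrightarrow> smooth_on A U (\<lambda>x. c * f x)"
  by (intro smooth_on_mult smooth_on_const)

text \<open>Smoothness on a chart domain may be tested in that chart alone: the other coordinate
  expressions are obtained from it by composition with transition maps.\<close>

lemma smooth_on_chart_compose:
  assumes c: "(D, \<phi>) \<in> A" and U: "open U" "U \<subseteq> D" and G: "Cinf_on (\<phi> ` U) G"
  shows "smooth_on A U (\<lambda>q. G (\<phi> q))"
  unfolding smooth_on_def
proof clarify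
  fix D' \<phi>' assume c': "(D', \<phi>') \<in> A"
  obtain E :: "'e set" where E: "parseval_frame E" by (rule model_frame)
  have T: "Cinf_on (\<phi>' ` (D' \<inter> D)) (\<phi> \<circ> inv_into D' \<phi>')"
    using manifold c c' unfolding smooth_manifold_def by blast
  have "Cinf_on (\<phi>' ` (D' \<inter> U)) (\<lambda>x. G ((\<phi> \<circ> inv_into D' \<phi>') x))"
  proof (rule Cinf_on_compose[OF E chart_image_open[OF c' U(1)] _ G])
    show "(\<phi> \<circ> inv_into D' \<phi>') ` \<phi>' ` (D' \<inter> U) \<subseteq> \<phi> ` U"
      using chart_inverse[OF c'] by auto
    show "Cinf_on (\<phi>' ` (D' \<inter> U)) (\<phi> \<circ> inv_into D' \<phi>')"
      using U(2) by (intro Cinf_on_subset[OF T]) auto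
  qed
  then show "Cinf_on (\<phi>' ` (D' \<inter> U)) ((\<lambda>q. G (\<phi> q)) \<circ> inv_into D' \<phi>')"
    by (simp add: comp_def)
qed

lemma smooth_near_const: "smooth_near A p (\<lambda>x. c)"
  by (rule smooth_nearI[of UNIV]) (auto intro: smooth_on_const)

lemma smooth_near_add:
  "smooth_near A p f \<Longrightarrow> smooth_near A p g \<Longrightarrow> smooth_near A p (\<lambda>x. f x + g x)"
  by (erule (1) smooth_near_common) (blast intro: smooth_nearI smooth_on_add)

lemma smooth_near_mult:
  "smooth_near A p f \<Longrightarrow> smooth_near A p g \<Longrightarrow> smooth_near A p (\<lambda>x. f x * g x)"
  by (erule (1) smooth_near_common) (blast intro: smooth_nearI smooth_on_mult)

lemma smooth_near_cmult: "smooth_near A p f \<Longrightarrow> smooth_near A p (\<lambda>x. c * f x)"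
  by (intro smooth_near_mult smooth_near_const)

lemma smooth_near_sum:
  "finite I \<Longrightarrow> (\<And>i. i \<in> I \<Longrightarrow> smooth_near A p (f i)) \<Longrightarrow> smooth_near A p (\<lambda>x. \<Sum>i\<in>I. f i x)"
  by (induction I rule: finite_induct) (auto intro: smooth_near_const smooth_near_add)

lemma smooth_near_cong:
  assumes "open U" "p \<in> U" "\<And>x. x \<in> U \<Longrightarrow> f x = g x" "smooth_near A p f"
  shows "smooth_near A p g"
proof -
  obtain V where "open V" "p \<in> V" "smooth_on A V f"
    using assms(4) unfolding smooth_near_def by blast
  moreover from this have "smooth_on A (U \<inter> V) g"
    using assms by (intro smooth_on_cong[of "U \<inter> V" f g]) (auto elim: smooth_on_subset)
  ultimately show ?thesis using assms by (intro smooth_nearI[of "U \<inter> V"]) auto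
qed

section \<open>Tangent vectors\<close>

lemma tangent_add:
  "v \<in> tangent_space A p \<Longrightarrow> smooth_near A p f \<Longrightarrow> smooth_near A p g \<Longrightarrow>
    v (\<lambda>x. f x + g x) = v f + v g"
  unfolding tangent_space_def by blast

lemma tangent_cmult:
  "v \<in> tangent_space A p \<Longrightarrow> smooth_near A p f \<Longrightarrow> v (\<lambda>x. c * f x) = c * v f"
  unfolding tangent_space_def by blast

lemma tangent_mult:
  "v \<in> tangent_space A p \<Longrightarrow> smooth_near A p f \<Longrightarrow> smooth_near A p g \<Longrightarrow>
    v (\<lambda>x. f x * g x) = v f * g p + f p * v g"
  unfolding tangent_space_def by blast

lemma tangent_not_smooth:
  "v \<in> tangent_space A p \<Longrightarrow> \<not> smooth_near A p f \<Longrightarrow> v f = 0"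
  unfolding tangent_space_def by blast

lemma tangent_const:
  assumes "v \<in> tangent_space A p"
  shows "v (\<lambda>x. c) = 0"
proof -
  have "v (\<lambda>x. 1) = 0"
    using tangent_mult[OF assms smooth_near_const smooth_near_const, of 1 1] by simp
  then show ?thesis using tangent_cmult[OF assms smooth_near_const, of c 1] by simp
qed

lemma tangent_diff:
  assumes "v \<in> tangent_space A p" "smooth_near A p f" "smooth_near A p g"
  shows "v (\<lambda>x. f x - g x) = v f - v g"
  using tangent_add[OF assms(1,2) smooth_near_cmult[OF assms(3), of "-1"]]
    tangent_cmult[OF assms(1,3), of "-1"] by simp

lemma tangent_sum:
  assumes "v \<in> tangent_space A p" "finite I" "\<And>i. i \<in> I \<Longrightarrow> smooth_near A p (f i)"
  shows "v (\<lambda>x. \<Sum>i\<in>I. f i x) = (\<Sum>i\<in>I. v (f i))"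
  using assms(2,3)
  by (induction I rule: finite_induct)
     (auto simp: tangent_const[OF assms(1)] tangent_add[OF assms(1)] smooth_near_sum)

text \<open>A function \<open>h\<close> vanishing on the neighbourhood \<open>U\<close> equals \<open>h\<close> times the indicator of the
  complement of \<open>U\<close>; both factors vanish at \<open>p\<close>, so the product rule kills \<open>h\<close>.  The indicator
  only has to be smooth near \<open>p\<close>, hence no bump functions occur.\<close>

lemma tangent_cong:
  assumes v: "v \<in> tangent_space A p" and U: "open U" "p \<in> U" and eq: "\<And>x. x \<in> U \<Longrightarrow> f x = g x"
  shows "v f = v g"
proof (cases "smooth_near A p f")
  case True
  then have g: "smooth_near A p g" using smooth_near_cong[OF U, of f g] eq by blast
  define h where "h x = f x - g x" for x
  define k :: "'m \<Rightarrow> real" where "k x = (if x \<in> U then 0 else 1)" for x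
  have "smooth_near A p h" "smooth_near A p k"
    using eq by (auto intro!: smooth_near_cong[OF U _ smooth_near_const, of 0] simp: h_def k_def)
  moreover have "h = (\<lambda>x. h x * k x)" using eq by (auto simp: h_def k_def)
  moreover have "h p = 0" "k p = 0" using U eq by (auto simp: h_def k_def)
  ultimately have "v h = 0" using tangent_mult[OF v, of h k] by simp
  then show ?thesis using tangent_diff[OF v True g] by (simp add: h_def[abs_def])
next
  case False
  then have "\<not> smooth_near A p g" using smooth_near_cong[OF U, of g f] eq by auto
  then show ?thesis using False tangent_not_smooth[OF v] by simp
qed

text \<open>The vector field on a chart domain whose coordinate expression is the constant \<open>w\<close>.\<close>

definition coordinate_field :: "'m set \<Rightarrow> ('m \<Rightarrow> 'e) \<Rightarrow> 'e \<Rightarrow> 'm \<Rightarrow> 'm tvec" where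
  "coordinate_field D \<phi> w q f =
     (if smooth_near A q f then frechet_derivative (f \<circ> inv_into D \<phi>) (at (\<phi> q)) w else 0)"

lemma smooth_near_chart_differentiable:
  assumes "(D, \<phi>) \<in> A" "q \<in> D" "smooth_near A q f"
  shows "(f \<circ> inv_into D \<phi>) differentiable (at (\<phi> q))"
proof -
  obtain U where "open U" "q \<in> U" "smooth_on A U f" using assms(3) unfolding smooth_near_def by blast
  then show ?thesis
    using assms unfolding smooth_on_def
    by (intro Cinf_on_differentiable[of "\<phi> ` (D \<inter> U)"]) auto
qed

lemma coordinate_field_tangent:
  assumes c: "(D, \<phi>) \<in> A" and q: "q \<in> D"
  shows "coordinate_field D \<phi> w q \<in> tangent_space A q"
proof -
  let ?i = "inv_into D \<phi>"
  have d: "((\<lambda>y. f (?i y)) has_derivative frechet_derivative (\<lambda>y. f (?i y)) (at (\<phi> q))) (at (\<phi> q))"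
    if "smooth_near A q f" for f
    using smooth_near_chart_differentiable[OF c q that]
    by (simp add: comp_def flip: frechet_derivative_works)
  have add: "frechet_derivative (\<lambda>y. f (?i y) + g (?i y)) (at (\<phi> q)) w =
      frechet_derivative (\<lambda>y. f (?i y)) (at (\<phi> q)) w + frechet_derivative (\<lambda>y. g (?i y)) (at (\<phi> q)) w"
    if "smooth_near A q f" "smooth_near A q g" for f g
    using fun_cong[OF frechet_derivative_at[OF has_derivative_add[OF d[OF that(1)] d[OF that(2)]]]]
    by simp
  have cmult: "frechet_derivative (\<lambda>y. r * f (?i y)) (at (\<phi> q)) w =
      r * frechet_derivative (\<lambda>y. f (?i y)) (at (\<phi> q)) w"
    if "smooth_near A q f" for f r
    using fun_cong[OF frechet_derivative_at[OF has_derivative_mult_right[OF d[OF that]]]]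
    by simp
  have mult: "frechet_derivative (\<lambda>y. f (?i y) * g (?i y)) (at (\<phi> q)) w =
      frechet_derivative (\<lambda>y. f (?i y)) (at (\<phi> q)) w * g q +
      f q * frechet_derivative (\<lambda>y. g (?i y)) (at (\<phi> q)) w"
    if "smooth_near A q f" "smooth_near A q g" for f g
    using fun_cong[OF frechet_derivative_at[OF has_derivative_mult[OF d[OF that(1)] d[OF that(2)]]], of w]
      chart_inverse[OF c q]
    by simp
  show ?thesis
    unfolding tangent_space_def coordinate_field_def comp_def
    using add cmult mult by (auto simp: smooth_near_add smooth_near_mult smooth_near_cmult)
qed

lemma coordinate_field_vector_field:
  assumes c: "(D, \<phi>) \<in> A"
  shows "vector_field_on A D (coordinate_field D \<phi> w)"
  unfolding vector_field_on_def
proof (intro conjI ballI allI impI)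
  fix V f assume V: "open V" "V \<subseteq> D" and f: "smooth_on A V f"
  have "D \<inter> V = V" using V by auto
  with f c have "Cinf_on (\<phi> ` V) (f \<circ> inv_into D \<phi>)" unfolding smooth_on_def by fastforce
  from smooth_on_chart_compose[OF c V Cinf_on_derivative[OF this, of w]]
  show "smooth_on A V (\<lambda>p. coordinate_field D \<phi> w p f)"
    by (rule smooth_on_cong[OF V(1), rotated])
       (auto simp: coordinate_field_def smooth_nearI[OF V(1) _ f])
qed (rule coordinate_field_tangent[OF c])

text \<open>Hadamard's lemma writes a function near \<open>p\<close> as a constant plus \<open>\<Sum>b\<in>E. x\<^sub>b * k\<^sub>b\<close> with
  coordinates \<open>x\<^sub>b\<close> vanishing at \<open>p\<close> and smooth \<open>k\<^sub>b\<close>; the product rule then shows that a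
  derivation is determined by its values on the \<open>x\<^sub>b\<close>.\<close>

lemma tangent_is_coordinate:
  assumes c: "(D, \<phi>) \<in> A" and p: "p \<in> D" and v: "v \<in> tangent_space A p"
  shows "\<exists>w. v = coordinate_field D \<phi> w p"
proof -
  obtain E :: "'e set" where E: "parseval_frame E" by (rule model_frame)
  then have finE: "finite E" by (simp add: parseval_frame_def)
  note D = chart_homeomorphism(1)[OF c]
  define x where "x b q = (\<phi> q - \<phi> p) \<bullet> b" for b q
  have x: "smooth_near A p (x b)" for b
  proof -
    have "bounded_linear (\<lambda>y::'e. y \<bullet> b)" by (rule bounded_linear_inner_left)
    then have "Cinf_on (\<phi> ` D) (\<lambda>y. y \<bullet> b + - (\<phi> p \<bullet> b))"
      by (intro Cinf_on_add Cinf_on_const Cinf_on_bounded_linear[OF _ _ Cinf_on_id]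
            chart_homeomorphism(2)[OF c])
    from smooth_on_chart_compose[OF c D order_refl this] show ?thesis
      by (intro smooth_nearI[OF D p]) (simp add: x_def[abs_def] inner_diff_left)
  qed
  define w where "w = (\<Sum>b\<in>E. v (x b) *\<^sub>R b)"
  have "v f = coordinate_field D \<phi> w p f" for f
  proof (cases "smooth_near A p f")
    case True
    then obtain U where U: "open U" "p \<in> U" "smooth_on A U f" unfolding smooth_near_def by blast
    define F where "F = f \<circ> inv_into D \<phi>"
    have "open (\<phi> ` (D \<inter> U))" "\<phi> p \<in> \<phi> ` (D \<inter> U)"
      using chart_image_open[OF c U(1)] p U by auto
    then obtain r where r: "r > 0" "ball (\<phi> p) r \<subseteq> \<phi> ` (D \<inter> U)"
      by (meson open_contains_ball)
    have F: "Cinf_on (ball (\<phi> p) r) F"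
      using U(3) c unfolding smooth_on_def F_def by (intro Cinf_on_subset[OF _ r(2)]) auto
    define V where "V = D \<inter> \<phi> -` ball (\<phi> p) r"
    have V: "open V" "p \<in> V" "V \<subseteq> D"
      using chart_preimage_open[OF c open_ball] p r by (auto simp: V_def)
    define k where "k b y = integral {0..1}
      (\<lambda>t. frechet_derivative F (at (\<phi> p + t *\<^sub>R (y - \<phi> p))) b)" for b y
    have k: "smooth_near A p (\<lambda>q. k b (\<phi> q))" for b
    proof (rule smooth_nearI[OF V(1,2) smooth_on_chart_compose[OF c V(1,3)]])
      have "Cinf_on (ball (\<phi> p) r) (k b)"
        using Cinf_on_radial_average[OF E Cinf_on_derivative[OF F, of b], of 0]
        by (simp add: k_def[abs_def])
      then show "Cinf_on (\<phi> ` V) (k b)"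
        by (rule Cinf_on_subset) (auto simp: V_def)
    qed
    have kp: "k b (\<phi> p) = frechet_derivative F (at (\<phi> p)) b" for b by (simp add: k_def)
    have "v f = v (\<lambda>q. F (\<phi> p) + (\<Sum>b\<in>E. x b q * k b (\<phi> q)))"
    proof (rule tangent_cong[OF v V(1,2)])
      fix q assume q: "q \<in> V"
      then have "f q = F (\<phi> q)" using V chart_inverse[OF c] by (auto simp: F_def)
      also have "\<dots> = F (\<phi> p) + (\<Sum>b\<in>E. x b q * k b (\<phi> q))"
        unfolding x_def k_def by (rule hadamard_expansion[OF E F]) (use q in \<open>auto simp: V_def\<close>)
      finally show "f q = F (\<phi> p) + (\<Sum>b\<in>E. x b q * k b (\<phi> q))" .
    qed
    also have "\<dots> = v (\<lambda>q. \<Sum>b\<in>E. x b q * k b (\<phi> q))"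
      using tangent_add[OF v smooth_near_const smooth_near_sum[OF finE smooth_near_mult[OF x k]]]
      by (simp add: tangent_const[OF v])
    also have "\<dots> = (\<Sum>b\<in>E. v (\<lambda>q. x b q * k b (\<phi> q)))"
      by (rule tangent_sum[OF v finE smooth_near_mult[OF x k]])
    also have "\<dots> = (\<Sum>b\<in>E. v (x b) * frechet_derivative F (at (\<phi> p)) b)"
      by (simp add: tangent_mult[OF v x k] kp) (simp add: x_def)
    also have "\<dots> = frechet_derivative F (at (\<phi> p)) w"
      using linear_frechet_derivative[OF smooth_near_chart_differentiable[OF c p True]]
      by (simp add: w_def F_def linear_sum linear_scale)
    finally show ?thesis using True by (simp add: coordinate_field_def F_def)
  qed (simp add: tangent_not_smooth[OF v] coordinate_field_def)
  then show ?thesis by blast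
qed

lemma tangent_extension:
  assumes "v \<in> tangent_space A p"
  obtains U Y where "open U" "p \<in> U" "vector_field_on A U Y" "Y p = v"
proof -
  obtain D \<phi> where c: "(D, \<phi>) \<in> A" "p \<in> D" by (rule chart_at)
  obtain w where "v = coordinate_field D \<phi> w p" using tangent_is_coordinate[OF c assms] by blast
  then show ?thesis
    using that[OF chart_homeomorphism(1)[OF c(1)] c(2) coordinate_field_vector_field[OF c(1)]] by simp
qed

section \<open>Vector fields, Lie brackets and differentials\<close>

lemma tangent_space_add:
  assumes "u \<in> tangent_space A p" "v \<in> tangent_space A p"
  shows "(\<lambda>f. u f + v f) \<in> tangent_space A p"
  using assms unfolding tangent_space_def by (auto simp: algebra_simps)

lemma tangent_space_scale:
  assumes "v \<in> tangent_space A p"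
  shows "(\<lambda>f. c * v f) \<in> tangent_space A p"
  using assms unfolding tangent_space_def by (auto simp: algebra_simps)

lemma vector_field_on_subset: "vector_field_on A U X \<Longrightarrow> V \<subseteq> U \<Longrightarrow> vector_field_on A V X"
  unfolding vector_field_on_def by (meson subset_iff)

lemma vector_field_tangent: "vector_field_on A U X \<Longrightarrow> p \<in> U \<Longrightarrow> X p \<in> tangent_space A p"
  by (simp add: vector_field_on_def)

lemma vector_field_smooth:
  "vector_field_on A U X \<Longrightarrow> open V \<Longrightarrow> V \<subseteq> U \<Longrightarrow> smooth_on A V f \<Longrightarrow>
    smooth_on A V (\<lambda>p. X p f)"
  by (simp add: vector_field_on_def)

lemma vector_field_smooth_near:
  assumes "open U" "vector_field_on A U X" "p \<in> U" "smooth_near A p f"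
  shows "smooth_near A p (\<lambda>q. X q f)"
proof -
  obtain V where V: "open V" "p \<in> V" "smooth_on A V f"
    using assms(4) unfolding smooth_near_def by blast
  then have "smooth_on A (U \<inter> V) (\<lambda>q. X q f)"
    using assms by (intro vector_field_smooth[OF assms(2)]) (auto elim: smooth_on_subset)
  then show ?thesis using V assms by (intro smooth_nearI[of "U \<inter> V"]) auto
qed

lemma vector_field_on_add:
  assumes "vector_field_on A U X" "vector_field_on A U Y"
  shows "vector_field_on A U (\<lambda>p f. X p f + Y p f)"
  using assms unfolding vector_field_on_def by (auto intro!: tangent_space_add smooth_on_add)

lemma vector_field_on_mult:
  assumes "smooth_on A U h" "vector_field_on A U X"
  shows "vector_field_on A U (\<lambda>p f. h p * X p f)"
  using assms unfolding vector_field_on_def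
  by (auto intro!: tangent_space_scale smooth_on_mult elim: smooth_on_subset)

lemma vector_field_on_zero: "vector_field_on A U (\<lambda>p f. 0)"
  unfolding vector_field_on_def tangent_space_def by (simp add: smooth_on_const)

lemma second_derivative_add:
  assumes U: "open U" "p \<in> U" and X: "vector_field_on A U X" and Y: "vector_field_on A U Y"
    and f: "smooth_near A p f" and g: "smooth_near A p g"
  shows "X p (\<lambda>q. Y q (\<lambda>x. f x + g x)) = X p (\<lambda>q. Y q f) + X p (\<lambda>q. Y q g)"
proof -
  obtain V where V: "open V" "p \<in> V" "smooth_on A V f" "smooth_on A V g"
    using f g by (rule smooth_near_common)
  note Xp = vector_field_tangent[OF X U(2)]
  have "X p (\<lambda>q. Y q (\<lambda>x. f x + g x)) = X p (\<lambda>q. Y q f + Y q g)"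
    by (rule tangent_cong[OF Xp, of "U \<inter> V"])
       (use U V vector_field_tangent[OF Y] in \<open>auto intro!: tangent_add smooth_nearI[of V]\<close>)
  also have "\<dots> = X p (\<lambda>q. Y q f) + X p (\<lambda>q. Y q g)"
    by (intro tangent_add[OF Xp] vector_field_smooth_near[OF U(1) Y U(2)] f g)
  finally show ?thesis .
qed

lemma second_derivative_cmult:
  assumes U: "open U" "p \<in> U" and X: "vector_field_on A U X" and Y: "vector_field_on A U Y"
    and f: "smooth_near A p f"
  shows "X p (\<lambda>q. Y q (\<lambda>x. c * f x)) = c * X p (\<lambda>q. Y q f)"
proof -
  obtain V where V: "open V" "p \<in> V" "smooth_on A V f"
    using f unfolding smooth_near_def by blast
  note Xp = vector_field_tangent[OF X U(2)]
  have "X p (\<lambda>q. Y q (\<lambda>x. c * f x)) = X p (\<lambda>q. c * Y q f)"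
    by (rule tangent_cong[OF Xp, of "U \<inter> V"])
       (use U V vector_field_tangent[OF Y] in \<open>auto intro!: tangent_cmult smooth_nearI[of V]\<close>)
  also have "\<dots> = c * X p (\<lambda>q. Y q f)"
    by (intro tangent_cmult[OF Xp] vector_field_smooth_near[OF U(1) Y U(2)] f)
  finally show ?thesis .
qed

lemma second_derivative_mult:
  assumes U: "open U" "p \<in> U" and X: "vector_field_on A U X" and Y: "vector_field_on A U Y"
    and f: "smooth_near A p f" and g: "smooth_near A p g"
  shows "X p (\<lambda>q. Y q (\<lambda>x. f x * g x)) =
    X p (\<lambda>q. Y q f) * g p + Y p f * X p g + (X p f * Y p g + f p * X p (\<lambda>q. Y q g))"
proof -
  obtain V where V: "open V" "p \<in> V" "smooth_on A V f" "smooth_on A V g"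
    using f g by (rule smooth_near_common)
  note Xp = vector_field_tangent[OF X U(2)]
  note Yf = vector_field_smooth_near[OF U(1) Y U(2) f]
  note Yg = vector_field_smooth_near[OF U(1) Y U(2) g]
  have "X p (\<lambda>q. Y q (\<lambda>x. f x * g x)) = X p (\<lambda>q. Y q f * g q + f q * Y q g)"
    by (rule tangent_cong[OF Xp, of "U \<inter> V"])
       (use U V vector_field_tangent[OF Y] in \<open>auto intro!: tangent_mult smooth_nearI[of V]\<close>)
  also have "\<dots> = X p (\<lambda>q. Y q f * g q) + X p (\<lambda>q. f q * Y q g)"
    by (intro tangent_add[OF Xp] smooth_near_mult Yf Yg f g)
  finally show ?thesis
    by (simp only: tangent_mult[OF Xp Yf g] tangent_mult[OF Xp f Yg])
qed

text \<open>In \<open>XY - YX\<close> the mixed first-order terms of the product rule cancel.\<close>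

lemma lie_bracket_tangent:
  assumes U: "open U" "p \<in> U" and X: "vector_field_on A U X" and Y: "vector_field_on A U Y"
  shows "lie_bracket A X Y p \<in> tangent_space A p"
  unfolding tangent_space_def lie_bracket_def
  using second_derivative_add[OF U X Y] second_derivative_add[OF U Y X]
    second_derivative_cmult[OF U X Y] second_derivative_cmult[OF U Y X]
    second_derivative_mult[OF U X Y] second_derivative_mult[OF U Y X]
  by (simp add: smooth_near_add smooth_near_cmult smooth_near_mult algebra_simps)

lemma differential_tangent: "v \<in> tangent_space A p \<Longrightarrow> differential A f p v = v f"
  by (simp add: differential_def)

lemma differential_cotangent: "differential A f p \<in> cotangent_space A p"
  unfolding cotangent_space_def differential_def
  by (simp add: tangent_space_add tangent_space_scale)

lemma differential_one_form:
  assumes "smooth_on A U f"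
  shows "one_form_on A U (differential A f)"
  unfolding one_form_on_def
proof (intro conjI ballI allI impI differential_cotangent)
  fix V Y assume V: "open V" "V \<subseteq> U" and Y: "vector_field_on A V Y"
  have "smooth_on A V (\<lambda>p. Y p f)"
    by (rule vector_field_smooth[OF Y V(1) order_refl smooth_on_subset[OF assms V(2)]])
  then show "smooth_on A V (\<lambda>p. differential A f p (Y p))"
    by (rule smooth_on_cong[OF V(1), rotated])
       (simp add: differential_tangent[OF vector_field_tangent[OF Y]])
qed

text \<open>\<open>\<L>\<^sub>X\<close> commutes with \<open>d\<close>: on an extension \<open>Y\<close> of the vector \<open>v\<close> the Lie derivative of
  \<open>dg\<close> is \<open>X (Y g) - [X, Y] g = Y (X g)\<close>.  The definition chooses some extension of \<open>v\<close>, so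
  this needs that one exists.\<close>

lemma lie_derivative_differential:
  assumes X: "vector_field_on A UNIV X" and g: "smooth_on A UNIV g"
  shows "lie_derivative1 A X (differential A g) = differential A (\<lambda>q. X q g)"
proof (intro ext)
  fix p v
  show "lie_derivative1 A X (differential A g) p v = differential A (\<lambda>q. X q g) p v"
  proof (cases "v \<in> tangent_space A p")
    case True
    define Y where "Y = local_extension A p v"
    have "\<exists>Y. (\<exists>U. open U \<and> p \<in> U \<and> vector_field_on A U Y) \<and> Y p = v"
      by (rule tangent_extension[OF True]) blast
    then have "(\<exists>U. open U \<and> p \<in> U \<and> vector_field_on A U Y) \<and> Y p = v"
      unfolding Y_def local_extension_def by (rule someI_ex)
    then obtain U where U: "open U" "p \<in> U" and Y: "vector_field_on A U Y" and Yp: "Y p = v"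
      by blast
    have XU: "vector_field_on A U X" using X by (rule vector_field_on_subset) simp
    have "X p (\<lambda>q. differential A g q (Y q)) = X p (\<lambda>q. Y q g)"
      by (rule tangent_cong[OF vector_field_tangent[OF X] U])
         (simp_all add: differential_tangent[OF vector_field_tangent[OF Y]])
    moreover have "differential A g p (lie_bracket A X Y p) =
        X p (\<lambda>q. Y q g) - Y p (\<lambda>q. X q g)"
      using smooth_nearI[OF open_UNIV UNIV_I g]
      by (simp add: differential_tangent[OF lie_bracket_tangent[OF U XU Y]] lie_bracket_def)
    ultimately show ?thesis
      using True Yp by (simp add: lie_derivative1_def differential_def flip: Y_def)
  qed (simp add: lie_derivative1_def differential_def)
qed

end

section \<open>Hamiltonian vector fields\<close>

locale twisted_dirac_mfd = smooth_mfd A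
  for A :: "('m::{t2_space, second_countable_topology}, 'e::real_inner) atlas" +
  fixes H :: "'m form3" and L :: "'m \<Rightarrow> ('m tvec \<times> 'm covec) set"
  assumes closed: "closed_three_form A H"
    and dirac: "twisted_dirac A H L"
begin

lemma H_cotangent:
  assumes "v \<in> tangent_space A p" "w \<in> tangent_space A p"
  shows "(\<lambda>u. H p u v w) \<in> cotangent_space A p"
proof -
  have "\<forall>p. \<forall>v\<in>tangent_space A p. \<forall>w\<in>tangent_space A p.
      (\<lambda>u. H p u v w) \<in> cotangent_space A p"
    using closed unfolding closed_three_form_def three_form_def by (elim conjE)
  then show ?thesis using assms by blast
qed

lemma H_add:
  assumes "u \<in> tangent_space A p" "u' \<in> tangent_space A p"
    "v \<in> tangent_space A p" "w \<in> tangent_space A p"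
  shows "H p (\<lambda>f. u f + u' f) v w = H p u v w + H p u' v w"
  using H_cotangent[OF assms(3,4)] assms(1,2) unfolding cotangent_space_def by simp

lemma H_scale:
  assumes "u \<in> tangent_space A p" "v \<in> tangent_space A p" "w \<in> tangent_space A p"
  shows "H p (\<lambda>f. c * u f) v w = c * H p u v w"
  using H_cotangent[OF assms(2,3)] assms(1) unfolding cotangent_space_def by simp

lemma H_not_tangent:
  assumes "\<not> (v \<in> tangent_space A p \<and> w \<in> tangent_space A p)"
  shows "H p u v w = 0"
proof -
  have "\<forall>p u v w. H p u v w \<noteq> 0 \<longrightarrow>
      u \<in> tangent_space A p \<and> v \<in> tangent_space A p \<and> w \<in> tangent_space A p"
    using closed unfolding closed_three_form_def three_form_def by (elim conjE)
  then show ?thesis using assms by blast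
qed

lemma H_swap: "H p v u w = - H p u v w"
proof -
  have "\<forall>p u v w. H p v u w = - H p u v w \<and> H p u w v = - H p u v w"
    using closed unfolding closed_three_form_def three_form_def by (elim conjE)
  then show ?thesis by blast
qed

lemma L_combination:
  assumes "(u, \<alpha>) \<in> L p" "(v, \<beta>) \<in> L p"
  shows "(\<lambda>f. a * u f + b * v f, \<lambda>w. a * \<alpha> w + b * \<beta> w) \<in> L p"
proof -
  have "gen_subspace A p (L p)" using dirac unfolding twisted_dirac_def smooth_subbundle_def by blast
  then have sum: "\<And>u \<alpha> v \<beta>. (u, \<alpha>) \<in> L p \<Longrightarrow> (v, \<beta>) \<in> L p \<Longrightarrow>
      (\<lambda>f. u f + v f, \<lambda>w. \<alpha> w + \<beta> w) \<in> L p"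
    and scale: "\<And>c u \<alpha>. (u, \<alpha>) \<in> L p \<Longrightarrow> (\<lambda>f. c * u f, \<lambda>w. c * \<alpha> w) \<in> L p"
    unfolding gen_subspace_def by simp_all
  show ?thesis by (rule sum[OF scale[OF assms(1)] scale[OF assms(2)]])
qed

lemma L_isotropic:
  assumes "(u, \<alpha>) \<in> L p" "(v, \<beta>) \<in> L p"
  shows "\<alpha> v = - \<beta> u"
proof -
  have "isotropic (L p)" using dirac unfolding twisted_dirac_def maximally_isotropic_def by blast
  then have "pairing (u, \<alpha>) (v, \<beta>) = 0" using assms unfolding isotropic_def by blast
  then show ?thesis by (simp add: pairing_def)
qed

lemma hamiltonianI:
  assumes "vector_field_on A UNIV X" "smooth_on A UNIV f"
    "\<And>p. (X p, differential A f p) \<in> L p" "\<And>p v w. H p (X p) v w = 0"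
  shows "hamiltonian_vf A H L f X"
  using assms differential_one_form[OF assms(2)]
  unfolding hamiltonian_vf_def sections_def gen_section_on_def contract3_def
  by (simp add: fun_eq_iff)

lemma hamiltonianD:
  assumes "hamiltonian_vf A H L f X"
  shows "vector_field_on A UNIV X" "(X, differential A f) \<in> sections A L"
    "(X p, differential A f p) \<in> L p" "H p (X p) v w = 0"
  using assms unfolding hamiltonian_vf_def sections_def contract3_def
  by (auto dest: fun_cong)

lemma hamiltonian_const: "hamiltonian_vf A H L (\<lambda>x. c) (\<lambda>p f. 0)"
proof (rule hamiltonianI[OF vector_field_on_zero smooth_on_const])
  fix p v w
  have "differential A (\<lambda>x. c) p = (\<lambda>v. 0)" by (auto simp: differential_def tangent_const)
  then show "(\<lambda>f. 0, differential A (\<lambda>x. c) p) \<in> L p"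
    using dirac unfolding twisted_dirac_def smooth_subbundle_def gen_subspace_def by simp
  have "(\<lambda>f. 0) \<in> tangent_space A p" by (simp add: tangent_space_def)
  then show "H p (\<lambda>f. 0) v w = 0"
    using H_scale[of "\<lambda>f. 0" p v w 0] H_not_tangent[of v p w "\<lambda>f. 0"] by auto
qed

text \<open>Sums, scalar multiples and products of admissible functions are all functions \<open>k\<close> with
  \<open>dk = a df + b dg\<close>, for which \<open>aX + bY\<close> is Hamiltonian.\<close>

lemma hamiltonian_combination:
  assumes X: "hamiltonian_vf A H L f X" and Y: "hamiltonian_vf A H L g Y"
    and sm: "smooth_on A UNIV k" "smooth_on A UNIV a" "smooth_on A UNIV b"
    and dk: "\<And>p v. v \<in> tangent_space A p \<Longrightarrow> v k = a p * v f + b p * v g"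
  shows "hamiltonian_vf A H L k (\<lambda>p h. a p * X p h + b p * Y p h)"
proof (rule hamiltonianI[OF _ sm(1)])
  note XY = hamiltonianD(1)[OF X] hamiltonianD(1)[OF Y]
  show "vector_field_on A UNIV (\<lambda>p h. a p * X p h + b p * Y p h)"
    by (intro vector_field_on_add vector_field_on_mult sm XY)
  fix p v w
  have "differential A k p = (\<lambda>v. a p * differential A f p v + b p * differential A g p v)"
    by (auto simp: differential_def dk)
  then show "(\<lambda>h. a p * X p h + b p * Y p h, differential A k p) \<in> L p"
    using L_combination[OF hamiltonianD(3)[OF X] hamiltonianD(3)[OF Y]] by simp
  show "H p (\<lambda>h. a p * X p h + b p * Y p h) v w = 0"
  proof (cases "v \<in> tangent_space A p \<and> w \<in> tangent_space A p")
    case True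
    have "X p \<in> tangent_space A p" "Y p \<in> tangent_space A p"
      using vector_field_tangent[OF XY(1)] vector_field_tangent[OF XY(2)] by auto
    then show ?thesis
      using True hamiltonianD(4)[OF X] hamiltonianD(4)[OF Y]
      by (simp add: H_add H_scale tangent_space_scale)
  qed (rule H_not_tangent)
qed

text \<open>Isotropy of the pair \<open>(X, df)\<close>, \<open>(Y, dg)\<close>; as the right-hand side does not mention \<open>X\<close>,
  the bracket is independent of the Hamiltonian vector field of \<open>f\<close>.\<close>

lemma hamiltonian_skew:
  assumes X: "hamiltonian_vf A H L f X" and Y: "hamiltonian_vf A H L g Y"
  shows "X p g = - Y p f"
  using L_isotropic[OF hamiltonianD(3)[OF Y, of p] hamiltonianD(3)[OF X, of p]]
    vector_field_tangent[OF hamiltonianD(1)[OF X]] vector_field_tangent[OF hamiltonianD(1)[OF Y]]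
  by (simp add: differential_tangent)

text \<open>The twisting term vanishes as \<open>\<iota>\<^sub>X H = 0\<close>.  By skewness the other three terms of the 1-form
  part are multiples of \<open>d(X g)\<close>, with coefficients \<open>1\<close>, \<open>1\<close> and \<open>-1\<close>.\<close>

lemma twisted_courant_bracket_hamiltonian:
  assumes X: "hamiltonian_vf A H L f X" and Y: "hamiltonian_vf A H L g Y"
    and f: "smooth_on A UNIV f" and g: "smooth_on A UNIV g"
  shows "twisted_courant_bracket A H (X, differential A f) (Y, differential A g) =
    (lie_bracket A X Y, differential A (\<lambda>q. X q g))"
proof -
  note vX = hamiltonianD(1)[OF X] and vY = hamiltonianD(1)[OF Y]
  have Yf: "(\<lambda>q. Y q f) = (\<lambda>q. -1 * X q g)" using hamiltonian_skew[OF Y X] by auto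
  have c: "(\<lambda>q. contract1 X (differential A g) q - contract1 Y (differential A f) q) =
      (\<lambda>q. 2 * X q g)"
  proof
    fix q
    show "contract1 X (differential A g) q - contract1 Y (differential A f) q = 2 * X q g"
      using vector_field_tangent[OF vX] vector_field_tangent[OF vY] hamiltonian_skew[OF Y X, of q]
      by (simp add: contract1_def differential_tangent)
  qed
  have scale: "differential A (\<lambda>q. r * X q g) p v = r * differential A (\<lambda>q. X q g) p v" for r p v
    using smooth_nearI[OF open_UNIV UNIV_I vector_field_smooth[OF vX open_UNIV _ g]]
    by (auto simp: differential_def intro: tangent_cmult)
  show ?thesis
    unfolding twisted_courant_bracket_def courant_bracket_def
    by (simp add: lie_derivative_differential[OF vX g] lie_derivative_differential[OF vY f]
          c Yf scale[of 2] scale[of "-1", simplified] hamiltonianD(4)[OF X])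
qed

text \<open>Cartan's formula \<open>\<iota>\<^bsub>[X,Y]\<^esub> H = \<L>\<^sub>X \<iota>\<^sub>Y H - \<iota>\<^sub>Y \<L>\<^sub>X H\<close> in disguise: in \<open>dH(X, Y, Z, W) = 0\<close>
  all terms but \<open>H([X, Y], Z, W)\<close> have \<open>X\<close> or \<open>Y\<close> as an argument of \<open>H\<close>.\<close>

lemma contract_lie_bracket:
  assumes X: "hamiltonian_vf A H L f X" and Y: "hamiltonian_vf A H L g Y"
  shows "H p (lie_bracket A X Y p) v w = 0"
proof (cases "v \<in> tangent_space A p \<and> w \<in> tangent_space A p")
  case True
  obtain U Z where U: "open U" "p \<in> U" and Z: "vector_field_on A U Z" "Z p = v"
    using True by (blast elim: tangent_extension)
  obtain V W where V: "open V" "p \<in> V" and W: "vector_field_on A V W" "W p = w"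
    using True by (blast elim: tangent_extension)
  note vX = hamiltonianD(1)[OF X] and vY = hamiltonianD(1)[OF Y]
  have "vector_field_on A (U \<inter> V) X" "vector_field_on A (U \<inter> V) Y"
    "vector_field_on A (U \<inter> V) Z" "vector_field_on A (U \<inter> V) W"
    using vX vY Z(1) W(1) by (auto elim: vector_field_on_subset)
  moreover have "open (U \<inter> V)" "p \<in> U \<inter> V" using U V by auto
  ultimately have "ext_deriv3 A H X Y Z W p = 0"
    using closed unfolding closed_three_form_def by meson
  moreover have X0: "H q (X q) u u' = 0" "H q u (X q) u' = 0" for q u u'
    using hamiltonianD(4)[OF X] H_swap[of q u "X q" u'] by auto
  moreover have Y0: "H q (Y q) u u' = 0" "H q u (Y q) u' = 0" for q u u'
    using hamiltonianD(4)[OF Y] H_swap[of q u "Y q" u'] by auto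
  moreover have "X p (\<lambda>q. 0) = 0" "Y p (\<lambda>q. 0) = 0" "Z p (\<lambda>q. 0) = 0" "W p (\<lambda>q. 0) = 0"
    by (rule tangent_const, rule vector_field_tangent, rule vX vY Z(1) W(1), simp add: U V)+
  ultimately show ?thesis by (simp add: ext_deriv3_def Z(2) W(2))
qed (rule H_not_tangent)

text \<open>The section \<open>([X, Y], d(X g))\<close> lies in \<open>L\<close> because sections of \<open>L\<close> are closed under the
  twisted bracket.\<close>

lemma hamiltonian_lie_bracket:
  assumes X: "hamiltonian_vf A H L f X" and Y: "hamiltonian_vf A H L g Y"
    and f: "smooth_on A UNIV f" and g: "smooth_on A UNIV g"
  shows "hamiltonian_vf A H L (\<lambda>p. X p g) (lie_bracket A X Y)"
proof -
  have "twisted_courant_bracket A H (X, differential A f) (Y, differential A g) \<in> sections A L"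
    using dirac hamiltonianD(2)[OF X] hamiltonianD(2)[OF Y] unfolding twisted_dirac_def by blast
  then have "(lie_bracket A X Y, differential A (\<lambda>p. X p g)) \<in> sections A L"
    by (simp add: twisted_courant_bracket_hamiltonian[OF assms])
  then show ?thesis
    using contract_lie_bracket[OF X Y]
    by (simp add: hamiltonian_vf_def contract3_def sections_def gen_section_on_def fun_eq_iff)
qed

section \<open>The Poisson algebra of admissible functions\<close>

lemma admissibleI: "smooth_on A UNIV f \<Longrightarrow> hamiltonian_vf A H L f X \<Longrightarrow> f \<in> admissible A H L"
  unfolding admissible_def by blast

lemma admissibleE:
  assumes "f \<in> admissible A H L"
  obtains X where "smooth_on A UNIV f" "hamiltonian_vf A H L f X"
  using assms unfolding admissible_def by blast

lemma admissible_smooth_near: "f \<in> admissible A H L \<Longrightarrow> smooth_near A p f"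
  by (auto elim!: admissibleE intro: smooth_nearI[of UNIV])

lemma bracket_eq:
  assumes "hamiltonian_vf A H L f X" and "g \<in> admissible A H L"
  shows "bracket A H L f g = (\<lambda>p. X p g)"
proof
  fix p
  obtain Y where Y: "hamiltonian_vf A H L g Y" using assms(2) by (rule admissibleE)
  have "hamiltonian_vf A H L f (SOME X. hamiltonian_vf A H L f X)" using assms(1)
    by (rule someI[of "hamiltonian_vf A H L f"])
  then show "bracket A H L f g p = X p g"
    unfolding bracket_def using hamiltonian_skew[OF _ Y] assms(1) by metis
qed

lemma admissible_const: "(\<lambda>x. c) \<in> admissible A H L"
  by (rule admissibleI[OF smooth_on_const hamiltonian_const])

lemma hamiltonian_add:
  assumes "f \<in> admissible A H L" "g \<in> admissible A H L"
    "hamiltonian_vf A H L f X" "hamiltonian_vf A H L g Y"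
  shows "hamiltonian_vf A H L (\<lambda>x. f x + g x) (\<lambda>p h. X p h + Y p h)"
  using hamiltonian_combination[OF assms(3,4), of "\<lambda>x. f x + g x" "\<lambda>x. 1" "\<lambda>x. 1"] assms(1,2)
  by (auto simp: smooth_on_const smooth_on_add tangent_add admissible_smooth_near elim!: admissibleE)

lemma hamiltonian_cmult:
  assumes "f \<in> admissible A H L" "hamiltonian_vf A H L f X"
  shows "hamiltonian_vf A H L (\<lambda>x. c * f x) (\<lambda>p h. c * X p h)"
  using hamiltonian_combination[OF assms(2,2), of "\<lambda>x. c * f x" "\<lambda>x. c" "\<lambda>x. 0"] assms(1)
  by (auto simp: smooth_on_const smooth_on_cmult tangent_cmult admissible_smooth_near
      elim!: admissibleE)

lemma hamiltonian_mult:
  assumes "f \<in> admissible A H L" "g \<in> admissible A H L"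
    "hamiltonian_vf A H L f X" "hamiltonian_vf A H L g Y"
  shows "hamiltonian_vf A H L (\<lambda>x. f x * g x) (\<lambda>p h. g p * X p h + f p * Y p h)"
  using assms(1,2)
  by (intro hamiltonian_combination[OF assms(3,4)])
     (auto simp: smooth_on_mult tangent_mult admissible_smooth_near elim!: admissibleE)

lemma admissible_add:
  assumes "f \<in> admissible A H L" "g \<in> admissible A H L"
  shows "(\<lambda>x. f x + g x) \<in> admissible A H L"
  using assms hamiltonian_add[OF assms]
  by (auto elim!: admissibleE intro!: admissibleI smooth_on_add)

lemma admissible_cmult:
  assumes "f \<in> admissible A H L"
  shows "(\<lambda>x. c * f x) \<in> admissible A H L"
  using assms hamiltonian_cmult[OF assms]
  by (auto elim!: admissibleE intro!: admissibleI smooth_on_cmult)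

lemma admissible_mult:
  assumes "f \<in> admissible A H L" "g \<in> admissible A H L"
  shows "(\<lambda>x. f x * g x) \<in> admissible A H L"
  using assms hamiltonian_mult[OF assms]
  by (auto elim!: admissibleE intro!: admissibleI smooth_on_mult)

lemma bracket_hamiltonian:
  assumes "f \<in> admissible A H L" "g \<in> admissible A H L"
    "hamiltonian_vf A H L f X" "hamiltonian_vf A H L g Y"
  shows "hamiltonian_vf A H L (bracket A H L f g) (lie_bracket A X Y)"
  using assms hamiltonian_lie_bracket[OF assms(3,4)] bracket_eq[OF assms(3,2)]
  by (auto elim!: admissibleE)

lemma admissible_bracket:
  assumes f: "f \<in> admissible A H L" and g: "g \<in> admissible A H L"
  shows "bracket A H L f g \<in> admissible A H L"
proof -
  obtain X where X: "hamiltonian_vf A H L f X" using f by (rule admissibleE)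
  obtain Y where sg: "smooth_on A UNIV g" and Y: "hamiltonian_vf A H L g Y"
    using g by (rule admissibleE)
  have "smooth_on A UNIV (\<lambda>p. X p g)"
    by (rule vector_field_smooth[OF hamiltonianD(1)[OF X] open_UNIV subset_UNIV sg])
  then show ?thesis
    using bracket_hamiltonian[OF f g X Y] bracket_eq[OF X g] by (simp add: admissibleI)
qed

lemma bracket_skew:
  assumes f: "f \<in> admissible A H L" and g: "g \<in> admissible A H L"
  shows "bracket A H L f g = (\<lambda>x. - bracket A H L g f x)"
proof -
  obtain X where X: "hamiltonian_vf A H L f X" using f by (rule admissibleE)
  obtain Y where Y: "hamiltonian_vf A H L g Y" using g by (rule admissibleE)
  show ?thesis using hamiltonian_skew[OF X Y] bracket_eq[OF X g] bracket_eq[OF Y f] by simp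
qed

lemma bracket_add_right:
  assumes f: "f \<in> admissible A H L" and g: "g \<in> admissible A H L" and h: "h \<in> admissible A H L"
  shows "bracket A H L f (\<lambda>x. g x + h x) = (\<lambda>x. bracket A H L f g x + bracket A H L f h x)"
proof -
  obtain X where X: "hamiltonian_vf A H L f X" using f by (rule admissibleE)
  show ?thesis
    using tangent_add[OF vector_field_tangent[OF hamiltonianD(1)[OF X] UNIV_I]]
    by (simp add: bracket_eq[OF X] g h admissible_add admissible_smooth_near)
qed

lemma bracket_cmult_right:
  assumes f: "f \<in> admissible A H L" and g: "g \<in> admissible A H L"
  shows "bracket A H L f (\<lambda>x. c * g x) = (\<lambda>x. c * bracket A H L f g x)"
proof -
  obtain X where X: "hamiltonian_vf A H L f X" using f by (rule admissibleE)
  show ?thesis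
    using tangent_cmult[OF vector_field_tangent[OF hamiltonianD(1)[OF X] UNIV_I]]
    by (simp add: bracket_eq[OF X] g admissible_cmult admissible_smooth_near)
qed

lemma bracket_leibniz:
  assumes f: "f \<in> admissible A H L" and g: "g \<in> admissible A H L" and h: "h \<in> admissible A H L"
  shows "bracket A H L f (\<lambda>x. g x * h x) =
    (\<lambda>x. bracket A H L f g x * h x + g x * bracket A H L f h x)"
proof -
  obtain X where X: "hamiltonian_vf A H L f X" using f by (rule admissibleE)
  show ?thesis
    using tangent_mult[OF vector_field_tangent[OF hamiltonianD(1)[OF X] UNIV_I]]
    by (simp add: bracket_eq[OF X] g h admissible_mult admissible_smooth_near)
qed

text \<open>With Hamiltonian vector fields \<open>X\<close>, \<open>Y\<close> of \<open>f\<close>, \<open>g\<close> the cyclic sum is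
  \<open>X (Y h) - Y (X h) - [X, Y] h\<close>, because \<open>[X, Y]\<close> is Hamiltonian for the bracket of \<open>f\<close> and
  \<open>g\<close>.\<close>

lemma bracket_jacobi:
  assumes f: "f \<in> admissible A H L" and g: "g \<in> admissible A H L" and h: "h \<in> admissible A H L"
  shows "bracket A H L f (bracket A H L g h) x + bracket A H L g (bracket A H L h f) x
    + bracket A H L h (bracket A H L f g) x = 0"
proof -
  obtain X where X: "hamiltonian_vf A H L f X" using f by (rule admissibleE)
  obtain Y where Y: "hamiltonian_vf A H L g Y" using g by (rule admissibleE)
  note fg = admissible_bracket[OF f g] and fh = admissible_bracket[OF f h]
    and gh = admissible_bracket[OF g h]
  have "bracket A H L f (bracket A H L g h) x = X x (\<lambda>q. Y q h)"
    by (subst bracket_eq[OF X gh], subst bracket_eq[OF Y h]) (rule refl)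
  moreover have "bracket A H L g (bracket A H L h f) x = - Y x (\<lambda>q. X q h)"
  proof -
    have "bracket A H L h f = (\<lambda>x. -1 * bracket A H L f h x)" using bracket_skew[OF h f] by simp
    then have "bracket A H L g (bracket A H L h f) x = -1 * bracket A H L g (bracket A H L f h) x"
      using bracket_cmult_right[OF g fh, of "-1"] by metis
    also have "\<dots> = - Y x (\<lambda>q. X q h)" 
      by (subst bracket_eq[OF Y fh], subst bracket_eq[OF X h]) simp
    finally show ?thesis .
  qed
  moreover have "bracket A H L h (bracket A H L f g) x = - lie_bracket A X Y x h"
    using bracket_skew[OF h fg] bracket_eq[OF bracket_hamiltonian[OF f g X Y] h] by simp
  moreover have "lie_bracket A X Y x h = X x (\<lambda>q. Y q h) - Y x (\<lambda>q. X q h)"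
    by (simp add: lie_bracket_def admissible_smooth_near[OF h])
  ultimately show ?thesis by simp
qed

lemma poisson_algebra_admissible: "poisson_algebra (admissible A H L) (bracket A H L)"
proof -
  have add_left: "bracket A H L (\<lambda>x. f x + g x) h = (\<lambda>x. bracket A H L f h x + bracket A H L g h x)"
    if "f \<in> admissible A H L" "g \<in> admissible A H L" "h \<in> admissible A H L" for f g h
    using bracket_skew[OF admissible_add[OF that(1,2)] that(3)] bracket_add_right[OF that(3,1,2)]
      bracket_skew[OF that(1,3)] bracket_skew[OF that(2,3)] by simp
  have cmult_left: "bracket A H L (\<lambda>x. c * f x) g = (\<lambda>x. c * bracket A H L f g x)"
    if "f \<in> admissible A H L" "g \<in> admissible A H L" for c f g
    using bracket_skew[OF admissible_cmult[OF that(1)] that(2)] bracket_cmult_right[OF that(2,1)]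
      bracket_skew[OF that] by simp
  show ?thesis
    unfolding poisson_algebra_def
    by (intro conjI ballI allI admissible_const admissible_add admissible_cmult admissible_mult
          admissible_bracket add_left bracket_add_right cmult_left bracket_cmult_right bracket_skew
          bracket_jacobi bracket_leibniz)
qed

end

theorem theorem2p1:
  fixes A :: "('m::{t2_space, second_countable_topology}, 'e::real_inner) atlas"
    and H :: "'m form3"
    and L :: "'m \<Rightarrow> ('m tvec \<times> 'm covec) set"
    and f g :: "'m \<Rightarrow> real"
  assumes "smooth_manifold A"
    and "closed_three_form A H"
    and "twisted_dirac A H L"
    and "f \<in> admissible A H L"
    and "g \<in> admissible A H L"
  shows "(\<lambda>x. f x * g x) \<in> admissible A H L
    \<and> (\<forall>X. hamiltonian_vf A H L f X \<longrightarrow> bracket A H L f g = (\<lambda>p. X p g))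
    \<and> bracket A H L f g \<in> admissible A H L
    \<and> (\<forall>f1\<in>admissible A H L. \<forall>f2\<in>admissible A H L. \<forall>f3\<in>admissible A H L.
         bracket A H L f1 (\<lambda>x. f2 x * f3 x)
           = (\<lambda>x. bracket A H L f1 f2 x * f3 x + f2 x * bracket A H L f1 f3 x))
    \<and> (\<forall>f1\<in>admissible A H L. \<forall>f2\<in>admissible A H L. \<forall>f3\<in>admissible A H L. \<forall>x.
         bracket A H L f1 (bracket A H L f2 f3) x
           + bracket A H L f2 (bracket A H L f3 f1) x
           + bracket A H L f3 (bracket A H L f1 f2) x = 0)
    \<and> poisson_algebra (admissible A H L) (bracket A H L)"
proof -
  interpret twisted_dirac_mfd A H L using assms(1-3) by unfold_locales
  show ?thesis
    using assms(4,5)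
    by (intro conjI allI ballI impI admissible_mult bracket_eq admissible_bracket bracket_leibniz
          bracket_jacobi poisson_algebra_admissible)
qed

end
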